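(* Let $X$ be a $p$-dimensional random vector with symmetric multivariate Laplace distribution. Assume that its components $X_1,\dots,X_p$, being Laplace distributed, have distributions $\mathcal L(0,b_1),\dots,\mathcal L(0,b_p)$, respectively. Assume also that $\mathrm{corr}(X_i,X_j)=0$ for all $i\ne j$, $i,j\in\{1,\dots,p\}$. Let $p'<p$, and apply fastPRIM with the same probability $\beta$ on each possible projection of the space onto $p'$ of the $p$ variables. Then $$\arg\min_{B\in\mathcal B}\mathrm{Vol}(B\mid\beta)=\mathbf B,$$ where $\mathcal B$ is the collection of all the final boxes so obtained and $\mathbf B\in\mathcal B$ is the box obtained on the projection onto the $p'$ pettiest components.
   Context: The Laplace distribution $\mathcal L(0,b)$, $b>0$, has density $\frac1{2b}e^{-|x|/b}$ on $\mathbb R$ and variance $2b^2$. In a symmetric multivariate Laplace distribution the marginals are univariate Laplace, and uncorrelated marginals need not be independent. The components of a random vector are the variables obtained by rotating the space in the direction of the eigenvectors of its covariance matrix; here $X_1,\dots,X_p$ are already uncorrelated, so they are the components. The $p'$ pettiest components are the $p'$ components with the smallest variances. fastPRIM on a $p'$-dimensional projection, with probability $\beta$: let $\alpha$ and $L$ satisfy $(1-\alpha)^L=\beta$. At each of $L$ stages, make $2p'$ peelings, one from each side of the current axis-parallel box (starting from the whole space), each peeling having probability $\alpha(2p')^{-1}$. The final box has probability $\beta$, is centered at the mean, has its sides parallel to the axes of the components, and is a "square in probability", i.e. all its marginals have the same probability. The algorithm's description gives this common marginal probability as $\beta^{1/p'}$, the vertices being located at the quantiles $\frac12(1\pm\beta^{1/p'})$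 of the corresponding variables. There are $\binom{p}{p'}$ ways to choose $p'$ variables from the $p$ variables. For the choice indexed by $i$, $B_i$ is the final box obtained by fastPRIM on the corresponding projection, and $\mathcal B$ is the collection of all the $B_i$. For $B\in\mathcal B$, $\mathrm{Vol}(B\mid\beta)$ denotes the ($p'$-dimensional) Lebesgue measure of the box $B$ with probability measure $\beta$. *)

theory Defs
  imports "HOL-Probability.Probability"
begin

definition laplace_density :: "real \<Rightarrow> real \<Rightarrow> real" where
  "laplace_density b x = exp (- \<bar>x\<bar> / b) / (2 * b)"

definition corr :: "'a measure \<Rightarrow> ('a \<Rightarrow> real) \<Rightarrow> ('a \<Rightarrow> real) \<Rightarrow> real" where
  "corr M X Y =
     prob_space.expectation M (\<lambda>\<omega>. (X \<omega> - prob_space.expectation M X) * (Y \<omega> - prob_space.expectation M Y))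
       / (sqrt (prob_space.variance M X) * sqrt (prob_space.variance M Y))"

definition std_normal_vec :: "(real ^ 'n) measure" where
  "std_normal_vec = density lborel (\<lambda>z. ennreal (\<Prod>i\<in>UNIV. std_normal_density (z $ i)))"

(* The centred symmetric multivariate Laplace law with covariance matrix \<Sigma> is the law of
   sqrt W * Z, where W is standard exponential and Z, independent of W, is N(0, \<Sigma>);
   Z is realized as A *v (standard normal vector) for a square root A of \<Sigma>.
   Its characteristic function is 1 / (1 + (t \<bullet> \<Sigma> t) / 2). *)
definition symmetric_multivariate_laplace ::
    "'a measure \<Rightarrow> ('a \<Rightarrow> real ^ 'n) \<Rightarrow> real ^ 'n ^ 'n \<Rightarrow> bool" where
  "symmetric_multivariate_laplace M X \<Sigma> \<longleftrightarrow>
     X \<in> borel_measurable M \<and>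
     (\<exists>A :: real ^ 'n ^ 'n. A ** transpose A = \<Sigma> \<and>
        distr M borel X =
          distr (density lborel (exponential_density 1) \<Otimes>\<^sub>M std_normal_vec) borel
            (\<lambda>(w, z). sqrt w *\<^sub>R (A *v z)))"

definition proj_law :: "'a measure \<Rightarrow> ('a \<Rightarrow> real ^ 'n) \<Rightarrow> 'n set \<Rightarrow> ('n \<Rightarrow> real) measure" where
  "proj_law M X I = distr M (Pi\<^sub>M I (\<lambda>_. borel)) (\<lambda>\<omega>. \<lambda>i\<in>I. X \<omega> $ i)"

(* Sides may be infinite, so that the whole space is a box as well. *)
definition box_on :: "'n set \<Rightarrow> ('n \<Rightarrow> ereal) \<Rightarrow> ('n \<Rightarrow> ereal) \<Rightarrow> ('n \<Rightarrow> real) set" where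
  "box_on I l u = {x \<in> I \<rightarrow>\<^sub>E UNIV. \<forall>i\<in>I. l i \<le> ereal (x i) \<and> ereal (x i) \<le> u i}"

(* One stage: 2 * card I disjoint peelings R (i, s), the one for the lower (s = False) or the upper
   (s = True) i-th side consisting of points cut off by moving that side inwards, each having
   probability \<alpha> / (2 * card I) relative to the current box.  A point beyond several of the new
   sides is counted for exactly one of them, in whatever way makes the probabilities come out;
   only so can a stage remove exactly the proportion \<alpha> and still treat all sides alike. *)
definition peeling_stage ::
    "('n \<Rightarrow> real) measure \<Rightarrow> 'n set \<Rightarrow> real \<Rightarrow>
     ('n \<Rightarrow> ereal) \<Rightarrow> ('n \<Rightarrow> ereal) \<Rightarrow> ('n \<Rightarrow> ereal) \<Rightarrow> ('n \<Rightarrow> ereal) \<Rightarrow> bool" where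
  "peeling_stage Q I \<alpha> l u l' u' \<longleftrightarrow>
     (\<forall>i\<in>I. l i \<le> l' i \<and> u' i \<le> u i) \<and>
     (\<exists>R :: 'n \<times> bool \<Rightarrow> ('n \<Rightarrow> real) set.
        (\<forall>i\<in>I. R (i, False) \<subseteq> {x \<in> box_on I l u. ereal (x i) < l' i} \<and>
               R (i, True) \<subseteq> {x \<in> box_on I l u. u' i < ereal (x i)}) \<and>
        disjoint_family_on R (I \<times> UNIV) \<and>
        (\<Union>k \<in> I \<times> UNIV. R k) = box_on I l u - box_on I l' u' \<and>
        (\<forall>k \<in> I \<times> UNIV. R k \<in> sets Q \<and>
           measure Q (R k) = \<alpha> / (2 * real (card I)) * measure Q (box_on I l u)))"

(* Final boxes of fastPRIM.  Together with the stages, the requirements that the box be centred at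
   the mean and that its marginals be equally likely determine it. The common marginal
   probability \<gamma> is left open: it equals (1 - \<alpha>) ^ L to the power 1 / card I for independent
   coordinates, but not for the dependent coordinates of a multivariate Laplace vector. *)
definition fastPRIM_box ::
    "('n \<Rightarrow> real) measure \<Rightarrow> 'n set \<Rightarrow> real \<Rightarrow> nat \<Rightarrow> ('n \<Rightarrow> real) set \<Rightarrow> bool" where
  "fastPRIM_box Q I \<alpha> L B \<longleftrightarrow>
     (\<exists>(l :: nat \<Rightarrow> 'n \<Rightarrow> ereal) (u :: nat \<Rightarrow> 'n \<Rightarrow> ereal) (h :: 'n \<Rightarrow> real) (\<gamma> :: real).
        l 0 = (\<lambda>_. -\<infinity>) \<and> u 0 = (\<lambda>_. \<infinity>) \<and>
        (\<forall>k<L. peeling_stage Q I \<alpha> (l k) (u k) (l (Suc k)) (u (Suc k))) \<and>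
        B = box_on I (l L) (u L) \<and>
        (\<forall>i\<in>I. l L i = ereal ((\<integral>x. x i \<partial>Q) - h i) \<and> u L i = ereal ((\<integral>x. x i \<partial>Q) + h i)) \<and>
        (\<forall>i\<in>I. measure Q {x \<in> space Q. l L i \<le> ereal (x i) \<and> ereal (x i) \<le> u L i} = \<gamma>))"

definition marginal_quantile :: "('n \<Rightarrow> real) measure \<Rightarrow> 'n \<Rightarrow> real \<Rightarrow> real" where
  "marginal_quantile Q i q = Inf {t. q \<le> measure Q {x \<in> space Q. x i \<le> t}}"

(* The box given by the explicit vertices used in the description of fastPRIM; each marginal has
   probability \<beta> powr (1 / card I), so its joint probability is \<beta> only in special cases
   such as independence. *)
definition fastPRIM_quantile_box ::
    "('n \<Rightarrow> real) measure \<Rightarrow> 'n set \<Rightarrow> real \<Rightarrow> ('n \<Rightarrow> real) set" where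
  "fastPRIM_quantile_box Q I \<beta> =
     box_on I (\<lambda>i. ereal (marginal_quantile Q i ((1 - \<beta> powr (1 / real (card I))) / 2)))
              (\<lambda>i. ereal (marginal_quantile Q i ((1 + \<beta> powr (1 / real (card I))) / 2)))"

(* A box is recorded together with the set I of variables spanning the space it lives in. *)
definition fastPRIM_boxes ::
    "'a measure \<Rightarrow> ('a \<Rightarrow> real ^ 'n) \<Rightarrow> nat \<Rightarrow> ('n set \<Rightarrow> real) \<Rightarrow> ('n set \<Rightarrow> nat) \<Rightarrow>
     ('n set \<times> ('n \<Rightarrow> real) set) set" where
  "fastPRIM_boxes M X p' \<alpha> L =
     {(I, B). card I = p' \<and> fastPRIM_box (proj_law M X I) I (\<alpha> I) (L I) B}"

definition fastPRIM_quantile_boxes ::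
    "'a measure \<Rightarrow> ('a \<Rightarrow> real ^ 'n) \<Rightarrow> nat \<Rightarrow> real \<Rightarrow> ('n set \<times> ('n \<Rightarrow> real) set) set" where
  "fastPRIM_quantile_boxes M X p' \<beta> =
     {(I, B). card I = p' \<and> B = fastPRIM_quantile_box (proj_law M X I) I \<beta>}"

definition Vol :: "'n set \<times> ('n \<Rightarrow> real) set \<Rightarrow> ennreal" where
  "Vol = (\<lambda>(I, B). emeasure (Pi\<^sub>M I (\<lambda>_. lborel)) B)"

(* I consists of the card I pettiest variables; with ties among the variances there may be several
   such sets of the same size. *)
definition pettiest :: "'a measure \<Rightarrow> ('a \<Rightarrow> real ^ 'n) \<Rightarrow> 'n set \<Rightarrow> bool" where
  "pettiest M X I \<longleftrightarrow>
     (\<forall>i\<in>I. \<forall>j\<in>-I. prob_space.variance M (\<lambda>\<omega>. X \<omega> $ i) \<le> prob_space.variance M (\<lambda>\<omega>. X \<omega> $ j))"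

end

theory Submission
  imports Defs "HOL-Real_Asymp.Real_Asymp"
begin

text \<open>Write \<open>X = \<surd>W A Z\<close>. The law of \<open>Y = \<surd>W Z\<close> is invariant under all rotations, so
  \<open>E (u \<bullet> Y) (v \<bullet> Y) = m (u \<bullet> v)\<close>; hence uncorrelatedness makes the rows of \<open>A\<close> orthogonal, with norms
  proportional to the scale parameters \<open>b i\<close>, and the standardized vector \<open>T = (X i / b i)\<close> is again
  rotation invariant. In particular its law is invariant under signed permutations of the coordinates.
  A final box centred at the mean with equally likely Laplace marginals has half-widths \<open>c * b i\<close>, and
  its probability \<open>P (\<forall>i\<in>I. \<bar>T i\<bar> \<le> c)\<close> is strictly increasing in \<open>c\<close> and depends on \<open>I\<close> only
  through \<open>card I\<close>. So the same \<open>c\<close> occurs for all projections, the volumes are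
  \<open>(2 * c) ^ p' * (\<Prod>i\<in>I. b i)\<close>, and the product is smallest exactly for the \<open>p'\<close> smallest scales.
  Such boxes do arise from peeling stages: cutting the shell between two consecutive boxes according
  to which \<open>\<bar>T i\<bar>\<close> is largest and to the sign of \<open>T i\<close> gives pieces of equal probability.\<close>

section \<open>Rotation invariance of the standard normal law\<close>

lemma borel_measurable_orthogonal_transformation:
  fixes f :: "'a::euclidean_space \<Rightarrow> 'a"
  shows "orthogonal_transformation f \<Longrightarrow> f \<in> borel_measurable borel"
  using linear_continuous_on borel_measurable_continuous_onI linear_conv_bounded_linear
    orthogonal_transformation_def by metis

lemma nn_integral_lborel_translation:
  fixes h :: "'a::euclidean_space \<Rightarrow> ennreal"
  assumes [measurable]: "h \<in> borel_measurable borel"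
  shows "(\<integral>\<^sup>+y. h (a + y) \<partial>lborel) = (\<integral>\<^sup>+y. h y \<partial>lborel)"
proof -
  have "(\<integral>\<^sup>+y. h y \<partial>lborel) = (\<integral>\<^sup>+y. h y \<partial>(distr lborel borel ((+) a)))"
    by (simp add: lborel_distr_plus)
  then show ?thesis
    by (simp add: nn_integral_distr)
qed

text \<open>The image \<open>\<mu>\<close> of Lebesgue measure \<open>\<lambda>\<close> is translation invariant, so that Fubini's theorem gives
  \<open>\<mu> B * \<lambda> A = \<mu> A * \<lambda> B\<close> for the unit ball \<open>B\<close>; and \<open>\<mu> B = \<lambda> B\<close>.\<close>

lemma distr_lborel_orthogonal_transformation:
  fixes f :: "'a::euclidean_space \<Rightarrow> 'a"
  assumes f: "orthogonal_transformation f"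
  shows "distr lborel borel f = lborel"
proof (rule measure_eqI)
  fix A assume "A \<in> sets (distr lborel borel f)"
  then have A [measurable]: "A \<in> sets borel" by simp
  let ?B = "ball (0::'a) 1"
  define g :: "'a \<Rightarrow> ennreal" where "g = indicator ?B"
  \<comment> \<open>The ball is symmetric about the origin. This lets the inner integral over
    \<open>y\<close> below be read as the integral of a translate of \<open>g\<close>.\<close>
  have g_uminus: "g (x - y) = g (- x + y)" for x y
    by (auto simp: g_def indicator_def dist_norm norm_minus_commute)
  have [measurable]: "g \<in> borel_measurable borel"
    by (auto simp: g_def intro!: borel_measurable_indicator)
  have [measurable]: "f \<in> borel_measurable borel" "inv f \<in> borel_measurable borel"
    using f by (auto intro!: borel_measurable_orthogonal_transformation orthogonal_transformation_inv)
  define \<mu> where "\<mu> = distr lborel borel f"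
  have [measurable_cong]: "sets \<mu> = sets borel" by (simp add: \<mu>_def)
  \<comment> \<open>The inverse map pushes \<open>\<mu>\<close> back to Lebesgue measure;
    sigma-finiteness, which Fubini's theorem requires, is inherited from there.\<close>
  have "distr \<mu> borel (inv f) = lborel"
    using f by (auto simp: \<mu>_def distr_distr comp_def orthogonal_transformation_inj distr_id2)
  then have "sigma_finite_measure (distr \<mu> borel (inv f))"
    by (simp add: lborel.sigma_finite_measure_axioms)
  then interpret \<mu>: sigma_finite_measure \<mu>
    by (rule sigma_finite_measure_distr) simp
  interpret P: pair_sigma_finite \<mu> lborel ..
  have \<mu>_translation: "(\<integral>\<^sup>+x. h (a + x) \<partial>\<mu>) = (\<integral>\<^sup>+x. h x \<partial>\<mu>)"
    if [measurable]: "h \<in> borel_measurable borel" for h a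
  proof -
    have "f (inv f a) = a"
      using f by (simp add: orthogonal_transformation_surj surj_f_inv_f)
    then have "h (a + f x) = h (f (inv f a + x))" for x
      using f by (simp add: orthogonal_transformation_def linear_add)
    then show ?thesis
      using nn_integral_lborel_translation[of "\<lambda>x. h (f x)" "inv f a"]
      by (simp add: \<mu>_def nn_integral_distr)
  qed
  have \<mu>B: "emeasure \<mu> ?B = emeasure lborel ?B"
  proof -
    have "f -` ?B = ?B"
      using f by (auto simp: orthogonal_transformation_norm)
    then show ?thesis by (simp add: \<mu>_def emeasure_distr)
  qed
  have \<mu>_g: "(\<integral>\<^sup>+x. g x \<partial>\<mu>) = emeasure \<mu> ?B" and "A \<in> sets \<mu>"
    by (auto simp: g_def \<mu>_def nn_integral_indicator)
  have "emeasure \<mu> ?B * emeasure lborel A = (\<integral>\<^sup>+x. g x * emeasure lborel A \<partial>\<mu>)"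
    by (simp add: nn_integral_multc \<mu>_g)
  also have "\<dots> = (\<integral>\<^sup>+x. (\<integral>\<^sup>+y. g x * indicator A y \<partial>lborel) \<partial>\<mu>)"
    by (simp add: nn_integral_cmult)
  also have "\<dots> = (\<integral>\<^sup>+x. (\<integral>\<^sup>+y. g x * indicator A (x + y) \<partial>lborel) \<partial>\<mu>)"
  proof (rule nn_integral_cong)
    fix x
    show "(\<integral>\<^sup>+y. g x * indicator A y \<partial>lborel) = (\<integral>\<^sup>+y. g x * indicator A (x + y) \<partial>lborel)"
      using nn_integral_lborel_translation[of "\<lambda>y. g x * indicator A y" x] by simp
  qed
  also have "\<dots> = (\<integral>\<^sup>+y. (\<integral>\<^sup>+x. g x * indicator A (x + y) \<partial>\<mu>) \<partial>lborel)"
    by (rule P.Fubini'[symmetric]) measurable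
  \<comment> \<open>This time the shift is made in \<open>x\<close>, by the translation invariance
    of \<open>\<mu>\<close>.\<close>
  also have "\<dots> = (\<integral>\<^sup>+y. (\<integral>\<^sup>+x. g (x - y) * indicator A x \<partial>\<mu>) \<partial>lborel)"
  proof (rule nn_integral_cong)
    fix y
    show "(\<integral>\<^sup>+x. g x * indicator A (x + y) \<partial>\<mu>) = (\<integral>\<^sup>+x. g (x - y) * indicator A x \<partial>\<mu>)"
      using \<mu>_translation[of "\<lambda>x. g (x - y) * indicator A x" y] by (simp add: add.commute)
  qed
  also have "\<dots> = (\<integral>\<^sup>+x. (\<integral>\<^sup>+y. g (x - y) * indicator A x \<partial>lborel) \<partial>\<mu>)"
    by (rule P.Fubini') measurable
  also have "\<dots> = (\<integral>\<^sup>+x. emeasure lborel ?B * indicator A x \<partial>\<mu>)"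
  proof (rule nn_integral_cong)
    fix x
    show "(\<integral>\<^sup>+y. g (x - y) * indicator A x \<partial>lborel) = emeasure lborel ?B * indicator A x"
      using nn_integral_lborel_translation[of g "- x", folded g_uminus]
      by (simp add: nn_integral_multc) (simp add: g_def)
  qed
  also have "\<dots> = emeasure lborel ?B * emeasure \<mu> A"
    using \<open>A \<in> sets \<mu>\<close> by (simp add: nn_integral_cmult)
  finally have "emeasure lborel ?B * emeasure lborel A = emeasure lborel ?B * emeasure \<mu> A"
    by (simp add: \<mu>B)
  moreover have "emeasure lborel ?B \<noteq> 0"
    using emeasure_lborel_ball_finite[of "0::'a" 1] content_ball_pos[of 1 "0::'a"]
    by (auto simp: measure_def)
  moreover have "emeasure lborel ?B \<noteq> \<infinity>"
    using emeasure_lborel_ball_finite[of "0::'a" 1] by auto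
  ultimately show "emeasure (distr lborel borel f) A = emeasure lborel A"
    by (simp add: ennreal_mult_cancel_left \<mu>_def)
qed simp

text \<open>The product of the one-dimensional Gaussian densities is radial, which is what makes the
  normal law invariant under rotations.\<close>

lemma prod_std_normal_density:
  fixes z :: "real ^ 'n"
  shows "(\<Prod>i\<in>UNIV. std_normal_density (z $ i)) = exp (- (norm z)\<^sup>2 / 2) / sqrt (2 * pi) ^ CARD('n)"
proof -
  have "(norm z)\<^sup>2 = (\<Sum>i\<in>UNIV. (z $ i)\<^sup>2)"
    by (simp add: power2_norm_eq_inner[unfolded power2_eq_square] inner_vec_def power2_eq_square)
  moreover have "(\<Prod>i\<in>(UNIV :: 'n set). exp (- (z $ i)\<^sup>2 / 2)) = exp (- (\<Sum>i\<in>UNIV. (z $ i)\<^sup>2) / 2)"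
    by (simp add: exp_sum[symmetric] sum_negf sum_divide_distrib)
  ultimately show ?thesis
    by (simp add: std_normal_density_def prod_dividef prod.distrib)
qed

lemma sets_std_normal_vec [measurable_cong, simp]: "sets std_normal_vec = sets borel"
  by (simp add: std_normal_vec_def)

lemma space_std_normal_vec [simp]: "space std_normal_vec = UNIV"
  by (simp add: std_normal_vec_def)

lemma std_normal_vec_altdef:
  "(std_normal_vec :: (real ^ 'n) measure) =
     density lborel (\<lambda>z. ennreal (exp (- (norm z)\<^sup>2 / 2) / sqrt (2 * pi) ^ CARD('n)))"
  unfolding std_normal_vec_def prod_std_normal_density ..

lemma sigma_finite_std_normal_vec: "sigma_finite_measure (std_normal_vec :: (real ^ 'n) measure)"
  unfolding std_normal_vec_altdef by (subst sigma_finite_measure.sigma_finite_iff_density_finite[OF sigma_finite_lborel]) auto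

text \<open>Lebesgue measure is invariant, and the density depends on the norm only.\<close>

lemma distr_std_normal_vec_orthogonal_transformation:
  fixes f :: "real ^ 'n \<Rightarrow> real ^ 'n"
  assumes f: "orthogonal_transformation f"
  shows "distr std_normal_vec borel f = std_normal_vec"
proof -
  define g :: "real ^ 'n \<Rightarrow> ennreal" where
    "g = (\<lambda>z. ennreal (exp (- (norm z)\<^sup>2 / 2) / sqrt (2 * pi) ^ CARD('n)))"
  have N: "std_normal_vec = density lborel g"
    unfolding std_normal_vec_altdef g_def ..
  have gf: "g (f z) = g z" for z
    using f by (simp add: g_def orthogonal_transformation_norm)
  have [measurable]: "f \<in> borel_measurable borel" "g \<in> borel_measurable borel"
    using borel_measurable_orthogonal_transformation[OF f] by (auto simp: g_def)
  have "distr (density lborel g) borel f = density (distr lborel borel f) g"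
    by (subst density_distr) (auto simp: gf)
  then show ?thesis
    using distr_lborel_orthogonal_transformation[OF f] N by simp
qed

text \<open>The Gaussian density vanishes nowhere, so Gaussian null sets are Lebesgue null.\<close>

lemma AE_std_normal_vec_imp_AE_lborel:
  assumes "AE z in (std_normal_vec :: (real ^ 'n) measure). P z"
  shows "AE z in (lborel :: (real ^ 'n) measure). P z"
  using assms unfolding std_normal_vec_altdef by (subst (asm) AE_density) (auto elim!: AE_mp)

section \<open>Rotation invariant laws\<close>

definition rotation_invariant :: "(real ^ 'n) measure \<Rightarrow> bool" where
  "rotation_invariant N \<longleftrightarrow>
     sets N = sets borel \<and> (\<forall>f. orthogonal_transformation f \<longrightarrow> distr N borel f = N)"

text \<open>Full support; it is what makes the probability of a cube strictly increasing in its
  half-width.\<close>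

definition positive_on_open :: "'a::topological_space measure \<Rightarrow> bool" where
  "positive_on_open N \<longleftrightarrow> (\<forall>U. open U \<longrightarrow> U \<noteq> {} \<longrightarrow> emeasure N U \<noteq> 0)"

lemma rotation_invariant_scaleR:
  fixes N :: "(real ^ 'n) measure"
  assumes N: "rotation_invariant N"
  shows "rotation_invariant (distr N borel (\<lambda>y. s *\<^sub>R y))"
proof -
  have [measurable_cong, simp]: "sets N = sets borel" using N by (simp add: rotation_invariant_def)
  show ?thesis
    unfolding rotation_invariant_def
  proof (intro conjI allI impI)
    fix f :: "real ^ 'n \<Rightarrow> real ^ 'n" assume f: "orthogonal_transformation f"
    have [measurable]: "f \<in> borel_measurable borel"
      by (rule borel_measurable_orthogonal_transformation[OF f])
    have "f (s *\<^sub>R y) = s *\<^sub>R f y" for y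
      using f by (simp add: orthogonal_transformation_def linear_cmul)
    then have "distr (distr N borel (\<lambda>y. s *\<^sub>R y)) borel f = distr (distr N borel f) borel (\<lambda>y. s *\<^sub>R y)"
      by (simp add: distr_distr comp_def)
    then show "distr (distr N borel (\<lambda>y. s *\<^sub>R y)) borel f = distr N borel (\<lambda>y. s *\<^sub>R y)"
      using N f by (simp add: rotation_invariant_def)
  qed simp
qed

lemma positive_on_open_scaleR:
  fixes N :: "'a::{second_countable_topology, real_normed_vector} measure"
  assumes N: "positive_on_open N" "sets N = sets borel" and s: "s \<noteq> 0"
  shows "positive_on_open (distr N borel (\<lambda>y. s *\<^sub>R y))"
  unfolding positive_on_open_def
proof (intro allI impI)
  fix U :: "'a set" assume U: "open U" "U \<noteq> {}"
  have [measurable_cong]: "sets N = sets borel" by fact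
  have "open ((\<lambda>y. s *\<^sub>R y) -` U)"
    using U by (intro open_vimage) (auto intro!: continuous_intros)
  moreover have "(\<lambda>y. s *\<^sub>R y) -` U \<noteq> {}"
  proof -
    obtain x where "x \<in> U" using U by auto
    then have "(1 / s) *\<^sub>R x \<in> (\<lambda>y. s *\<^sub>R y) -` U" using s by simp
    then show ?thesis by blast
  qed
  moreover have "space N = UNIV"
    using sets_eq_imp_space_eq[OF N(2)] by simp
  ultimately show "emeasure (distr N borel (\<lambda>y. s *\<^sub>R y)) U \<noteq> 0"
    using N U by (simp add: emeasure_distr positive_on_open_def)
qed

text \<open>Vectors of equal norm are related by an orthogonal map, which carries one linear
  functional to the other without changing the law.\<close>

lemma rotation_invariant_integral_inner:
  fixes h :: "real \<Rightarrow> real"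
  assumes N: "rotation_invariant N" and uv: "norm u = norm v"
    and [measurable]: "h \<in> borel_measurable borel"
  shows "integrable N (\<lambda>y. h (u \<bullet> y)) \<longleftrightarrow> integrable N (\<lambda>y. h (v \<bullet> y))"
    and "(\<integral>y. h (u \<bullet> y) \<partial>N) = (\<integral>y. h (v \<bullet> y) \<partial>N)"
proof -
  have [measurable_cong]: "sets N = sets borel" using N by (simp add: rotation_invariant_def)
  obtain f where f: "orthogonal_transformation f" "f u = v"
    using orthogonal_transformation_exists[OF uv] by blast
  have [measurable]: "f \<in> borel_measurable borel"
    by (rule borel_measurable_orthogonal_transformation[OF f(1)])
  have N_eq: "distr N borel f = N" using N f by (simp add: rotation_invariant_def)
  have "v \<bullet> f y = u \<bullet> y" for y
    using f by (auto simp: orthogonal_transformation_def)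
  then have *: "(\<lambda>y. h (u \<bullet> y)) = (\<lambda>y. h (v \<bullet> f y))" by simp
  show "integrable N (\<lambda>y. h (u \<bullet> y)) \<longleftrightarrow> integrable N (\<lambda>y. h (v \<bullet> y))"
    unfolding * by (subst (2) N_eq[symmetric], subst integrable_distr_eq) auto
  show "(\<integral>y. h (u \<bullet> y) \<partial>N) = (\<integral>y. h (v \<bullet> y) \<partial>N)"
    unfolding * by (subst (2) N_eq[symmetric], subst integral_distr) auto
qed

text \<open>By rotation and scaling, the second moment in one direction determines those in all
  directions; polarization then gives the mixed moments.\<close>

lemma rotation_invariant_second_moments:
  fixes N :: "(real ^ 'n) measure"
  assumes N: "rotation_invariant N" and a: "a \<noteq> 0" and int: "integrable N (\<lambda>y. (a \<bullet> y)\<^sup>2)"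
  obtains m where "\<And>u v. (\<integral>y. (u \<bullet> y) * (v \<bullet> y) \<partial>N) = m * (u \<bullet> v)"
proof -
  define m where "m = (\<integral>y. (a \<bullet> y)\<^sup>2 \<partial>N) / (norm a)\<^sup>2"
  have square: "integrable N (\<lambda>y. (u \<bullet> y)\<^sup>2) \<and> (\<integral>y. (u \<bullet> y)\<^sup>2 \<partial>N) = m * (norm u)\<^sup>2" for u
  proof -
    define r where "r = norm u / norm a"
    have *: "norm u = norm (r *\<^sub>R a)" using a by (simp add: r_def)
    have "(\<lambda>y. ((r *\<^sub>R a) \<bullet> y)\<^sup>2) = (\<lambda>y. r\<^sup>2 * (a \<bullet> y)\<^sup>2)"
      by (simp add: power_mult_distrib)
    then have "integrable N (\<lambda>y. ((r *\<^sub>R a) \<bullet> y)\<^sup>2)"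
        "(\<integral>y. ((r *\<^sub>R a) \<bullet> y)\<^sup>2 \<partial>N) = r\<^sup>2 * (\<integral>y. (a \<bullet> y)\<^sup>2 \<partial>N)"
      using int by simp_all
    then have "integrable N (\<lambda>y. (u \<bullet> y)\<^sup>2)" "(\<integral>y. (u \<bullet> y)\<^sup>2 \<partial>N) = r\<^sup>2 * (\<integral>y. (a \<bullet> y)\<^sup>2 \<partial>N)"
      using rotation_invariant_integral_inner[OF N *, of "\<lambda>x. x\<^sup>2"] by simp_all
    then show ?thesis
      by (simp add: m_def r_def power_divide)
  qed
  have "(\<integral>y. (u \<bullet> y) * (v \<bullet> y) \<partial>N) = m * (u \<bullet> v)" for u v
  proof -
    have polar: "(u \<bullet> y) * (v \<bullet> y) = (((u + v) \<bullet> y)\<^sup>2 - ((u - v) \<bullet> y)\<^sup>2) / 4" for y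
      by (simp add: inner_simps power2_eq_square algebra_simps)
    have "(\<integral>y. (u \<bullet> y) * (v \<bullet> y) \<partial>N) = (m * (norm (u + v))\<^sup>2 - m * (norm (u - v))\<^sup>2) / 4"
      unfolding polar using square[of "u + v"] square[of "u - v"] by simp
    also have "\<dots> = m * (u \<bullet> v)"
      by (simp add: power2_norm_eq_inner inner_simps inner_commute algebra_simps)
    finally show ?thesis .
  qed
  then show ?thesis by (rule that)
qed

section \<open>The Gaussian scale mixture with exponential mixing\<close>

definition normal_scale_mixture :: "(real ^ 'n) measure" where
  "normal_scale_mixture =
     distr (density lborel (exponential_density 1) \<Otimes>\<^sub>M std_normal_vec) borel (\<lambda>(w, z). sqrt w *\<^sub>R z)"

lemma sets_normal_scale_mixture [measurable_cong, simp]: "sets normal_scale_mixture = sets borel"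
  by (simp add: normal_scale_mixture_def)

text \<open>A linear map commutes with the scalar factor \<open>sqrt w\<close>, so it acts on the
  Gaussian factor alone, whose law it preserves.\<close>

lemma rotation_invariant_normal_scale_mixture:
  "rotation_invariant (normal_scale_mixture :: (real ^ 'n) measure)"
  unfolding rotation_invariant_def
proof (intro conjI allI impI)
  fix f :: "real ^ 'n \<Rightarrow> real ^ 'n" assume f: "orthogonal_transformation f"
  let ?E = "density lborel (exponential_density 1)" and ?Z = "std_normal_vec :: (real ^ 'n) measure"
  have [measurable]: "f \<in> borel_measurable borel"
    by (rule borel_measurable_orthogonal_transformation[OF f])
  have fZ: "distr ?Z borel f = ?Z"
    by (rule distr_std_normal_vec_orthogonal_transformation[OF f])
  have "distr ?E borel (\<lambda>w. w) \<Otimes>\<^sub>M distr ?Z borel f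
      = distr (?E \<Otimes>\<^sub>M ?Z) (borel \<Otimes>\<^sub>M borel) (\<lambda>(w, z). (w, f z))"
    by (rule pair_measure_distr) (simp_all add: fZ sigma_finite_std_normal_vec)
  then have pair: "distr (?E \<Otimes>\<^sub>M ?Z) (borel \<Otimes>\<^sub>M borel) (\<lambda>(w, z). (w, f z)) = ?E \<Otimes>\<^sub>M ?Z"
    by (simp add: fZ distr_id2)
  have "f (sqrt w *\<^sub>R z) = sqrt w *\<^sub>R f z" for w z
    using f by (simp add: orthogonal_transformation_def linear_cmul)
  then have "distr normal_scale_mixture borel f
      = distr (?E \<Otimes>\<^sub>M ?Z) borel (\<lambda>(w, z). sqrt w *\<^sub>R f z)"
    by (simp add: normal_scale_mixture_def distr_distr comp_def case_prod_unfold)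
  also have "\<dots> = distr (distr (?E \<Otimes>\<^sub>M ?Z) (borel \<Otimes>\<^sub>M borel) (\<lambda>(w, z). (w, f z))) borel
      (\<lambda>(w, z). sqrt w *\<^sub>R z)"
    by (simp add: distr_distr comp_def case_prod_unfold)
  also have "\<dots> = normal_scale_mixture"
    unfolding pair normal_scale_mixture_def ..
  finally show "distr normal_scale_mixture borel f = normal_scale_mixture" .
qed simp

text \<open>If an open set \<open>U\<close> were null, then for some \<open>w > 0\<close> the set of
  all \<open>z\<close> with \<open>sqrt w *\<^sub>R z\<close> in \<open>U\<close> would be null for
  the Gaussian law and hence for Lebesgue measure; but this set is open and nonempty.\<close>

lemma positive_on_open_normal_scale_mixture:
  "positive_on_open (normal_scale_mixture :: (real ^ 'n) measure)"
  unfolding positive_on_open_def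
proof (intro allI impI notI)
  fix U :: "(real ^ 'n) set"
  assume U: "open U" "U \<noteq> {}" and zero: "emeasure normal_scale_mixture U = 0"
  let ?E = "density lborel (exponential_density 1)" and ?Z = "std_normal_vec :: (real ^ 'n) measure"
  interpret E: prob_space ?E by (rule prob_space_exponential_density) simp
  interpret Z: sigma_finite_measure ?Z by (rule sigma_finite_std_normal_vec)
  interpret P: pair_sigma_finite ?E ?Z ..
  have [measurable]: "U \<in> sets borel" using U by simp
  have "AE y in normal_scale_mixture. y \<notin> U"
    using zero by (intro AE_I[of _ _ U]) auto
  then have "AE p in ?E \<Otimes>\<^sub>M ?Z. sqrt (fst p) *\<^sub>R snd p \<notin> U"
    unfolding normal_scale_mixture_def by (subst (asm) AE_distr_iff) (auto simp: case_prod_unfold)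
  from P.AE_pair[OF this] have "AE w in ?E. AE z in ?Z. sqrt w *\<^sub>R z \<notin> U"
    by simp
  \<comment> \<open>The exponential density is 0 on the negative axis, and the point 0 is Lebesgue
    null.\<close>
  moreover have "AE w in ?E. 0 < w"
    using AE_lborel_singleton[of "0::real"]
    by (subst AE_density) (auto elim!: AE_mp simp: exponential_density_def)
  ultimately have "AE w in ?E. 0 < w \<and> (AE z in ?Z. sqrt w *\<^sub>R z \<notin> U)" by auto
  moreover have "\<not> (AE w in ?E. False)" using E.AE_contr[of "\<lambda>_. False"] by auto
  ultimately have "\<exists>w. 0 < w \<and> (AE z in ?Z. sqrt w *\<^sub>R z \<notin> U)"
    by (intro eventually_happens'[of "ae_filter ?E"]) (auto simp: trivial_limit_def)
  then obtain w where w: "0 < w" and ae: "AE z in ?Z. sqrt w *\<^sub>R z \<notin> U" by blast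
  let ?V = "(\<lambda>z. sqrt w *\<^sub>R z) -` U"
  have V: "open ?V"
    using U by (intro open_vimage) (auto intro!: continuous_intros)
  obtain x where "x \<in> U" using U by auto
  then have "(1 / sqrt w) *\<^sub>R x \<in> ?V" using w by simp
  then have "?V \<noteq> {}" by blast
  have "AE z in lborel. z \<notin> ?V"
    using AE_std_normal_vec_imp_AE_lborel[OF ae] by simp
  then have "?V \<in> null_sets lborel"
    using V by (subst (asm) AE_iff_null_sets[symmetric]) auto
  then have "negligible ?V"
    by (simp add: negligible_iff_null_sets null_sets_completionI)
  then show False
    using open_not_negligible[OF V \<open>?V \<noteq> {}\<close>] by simp
qed

section \<open>The univariate Laplace distribution\<close>

lemma borel_measurable_laplace_density [measurable]: "laplace_density b \<in> borel_measurable borel"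
  unfolding laplace_density_def by measurable

lemma laplace_density_nonneg: "0 < b \<Longrightarrow> 0 \<le> laplace_density b x"
  by (simp add: laplace_density_def)

text \<open>On the half-line the Laplace density is half of the exponential density
  \<open>erlang_density 0 (1 / b)\<close>, whose moments are known. Moments over the whole line
  follow by parity.\<close>

lemma has_bochner_integral_laplace_half_moment:
  assumes b: "0 < b"
  shows "has_bochner_integral lborel (\<lambda>x. indicator {0..} x *\<^sub>R (laplace_density b x * x ^ k)) (fact k * b ^ k / 2)"
proof (rule has_bochner_integral_nn_integral)
  have "(\<integral>\<^sup>+x. ennreal (indicator {0..} x *\<^sub>R (laplace_density b x * x ^ k)) \<partial>lborel)
      = (\<integral>\<^sup>+x. ennreal (1 / 2 * (erlang_density 0 (1 / b) x * x ^ k)) \<partial>lborel)"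
    using b by (intro nn_integral_cong)
      (auto simp: laplace_density_def erlang_density_def split: split_indicator)
  also have "\<dots> = (\<integral>\<^sup>+x. ennreal (1 / 2) * ennreal (erlang_density 0 (1 / b) x * x ^ k) \<partial>lborel)"
    by (intro nn_integral_cong ennreal_mult') simp
  also have "\<dots> = ennreal (1 / 2) * ennreal (fact k * b ^ k)"
    using b nn_integral_erlang_ith_moment[of "1 / b" 0 k]
    by (subst nn_integral_cmult) (auto simp: field_simps)
  also have "\<dots> = ennreal (fact k * b ^ k / 2)"
    using b by (subst ennreal_mult'[symmetric]) auto
  finally show "(\<integral>\<^sup>+x. ennreal (indicator {0..} x *\<^sub>R (laplace_density b x * x ^ k)) \<partial>lborel)
      = ennreal (fact k * b ^ k / 2)" .
qed (use b in \<open>auto simp: laplace_density_nonneg split: split_indicator\<close>)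

context
  fixes M :: "'a measure" and Y :: "'a \<Rightarrow> real" and b :: real
  assumes dist: "distributed M lborel Y (laplace_density b)" and b: "0 < b"
begin

lemma laplace_mean: "(\<integral>\<omega>. Y \<omega> \<partial>M) = 0"
proof -
  have "has_bochner_integral lborel (\<lambda>x. laplace_density b x * x) 0"
    using has_bochner_integral_laplace_half_moment[OF b, of 1]
    by (intro has_bochner_integral_odd_function) (auto simp: laplace_density_def)
  then show ?thesis
    using distributed_integral[OF dist, of "\<lambda>x. x"] b
    by (simp add: laplace_density_nonneg has_bochner_integral_iff)
qed

lemma laplace_second_moment:
  "integrable M (\<lambda>\<omega>. (Y \<omega>)\<^sup>2)" "(\<integral>\<omega>. (Y \<omega>)\<^sup>2 \<partial>M) = 2 * b\<^sup>2"
proof -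
  have "has_bochner_integral lborel (\<lambda>x. laplace_density b x * x\<^sup>2) (2 *\<^sub>R b\<^sup>2)"
    using has_bochner_integral_laplace_half_moment[OF b, of 2]
    by (intro has_bochner_integral_even_function) (auto simp: laplace_density_def)
  then show "integrable M (\<lambda>\<omega>. (Y \<omega>)\<^sup>2)" "(\<integral>\<omega>. (Y \<omega>)\<^sup>2 \<partial>M) = 2 * b\<^sup>2"
    using distributed_integrable[OF dist, of "\<lambda>x. x\<^sup>2"] distributed_integral[OF dist, of "\<lambda>x. x\<^sup>2"] b
    by (simp_all add: laplace_density_nonneg has_bochner_integral_iff)
qed

text \<open>For nonnegative arguments the density has the antiderivative
  \<open>- exp (- x / b) / 2\<close>. That the strict and the non-strict tail agree is what later
  makes hyperplanes through the origin null.\<close>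

lemma laplace_tail:
  assumes c: "0 \<le> c"
  shows "measure M {\<omega> \<in> space M. c < Y \<omega>} = exp (- c / b) / 2"
    and "measure M {\<omega> \<in> space M. c \<le> Y \<omega>} = exp (- c / b) / 2"
proof -
  let ?f = "\<lambda>x. exp (- x / b) / (2 * b)"
  have "((\<lambda>x. - exp (- x / b) / 2) \<longlongrightarrow> 0) at_top"
    using b by real_asymp
  then have tail: "(\<integral>\<^sup>+x. ennreal (?f x) * indicator {c..} x \<partial>lborel) = ennreal (0 - - exp (- c / b) / 2)"
    using b by (intro nn_integral_FTC_atLeast) (auto intro!: derivative_eq_intros)
  have *: "measure M (Y -` S \<inter> space M) = exp (- c / b) / 2" if "S = {c<..} \<or> S = {c..}" for S
  proof -
    have "emeasure M (Y -` S \<inter> space M) = (\<integral>\<^sup>+x. ennreal (laplace_density b x) * indicator S x \<partial>lborel)"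
      using that by (intro distributed_emeasure[OF dist]) auto
    also have "\<dots> = (\<integral>\<^sup>+x. ennreal (?f x) * indicator {c..} x \<partial>lborel)"
      using c that AE_lborel_singleton[of c]
      by (intro nn_integral_cong_AE) (auto elim!: AE_mp simp: laplace_density_def split: split_indicator)
    finally show ?thesis
      using tail by (simp add: measure_def)
  qed
  show "measure M {\<omega> \<in> space M. c < Y \<omega>} = exp (- c / b) / 2"
    and "measure M {\<omega> \<in> space M. c \<le> Y \<omega>} = exp (- c / b) / 2"
    using *[of "{c<..}"] *[of "{c..}"] by (simp_all add: vimage_def Int_def conj_commute)
qed

end

section \<open>The standardized multivariate Laplace law\<close>

text \<open>This collects what is used about the standardized vector with coordinates
  \<open>X i / b i\<close>. The coordinates need not be independent; rotation invariance takes the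
  place of independence.\<close>

locale spherical_laplace = prob_space N for N :: "(real ^ 'n) measure" +
  assumes rotation_invariant: "rotation_invariant N"
    and positive_on_open: "positive_on_open N"
    and prob_tail: "0 \<le> c \<Longrightarrow> prob {t. c < t $ i} = exp (- c) / 2"
      "0 \<le> c \<Longrightarrow> prob {t. c \<le> t $ i} = exp (- c) / 2"

text \<open>Dividing coordinate \<open>i\<close> by \<open>b i\<close> turns \<open>A\<close> into
  \<open>s\<close> times a matrix \<open>Q\<close> with orthonormal rows. The rotation
  \<open>Q\<close> is absorbed by the invariance of the mixture, so only the scaling by
  \<open>s\<close> remains.\<close>

lemma spherical_laplace_standardized:
  fixes M :: "'a measure" and X :: "'a \<Rightarrow> real ^ 'n" and \<Sigma> :: "real ^ 'n ^ 'n" and b :: "'n \<Rightarrow> real"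
  assumes M: "prob_space M"
    and X: "symmetric_multivariate_laplace M X \<Sigma>"
    and b: "\<And>i. 0 < b i"
    and dist: "\<And>i. distributed M lborel (\<lambda>\<omega>. X \<omega> $ i) (laplace_density (b i))"
    and corr: "\<And>i j. i \<noteq> j \<Longrightarrow> corr M (\<lambda>\<omega>. X \<omega> $ i) (\<lambda>\<omega>. X \<omega> $ j) = 0"
  shows "spherical_laplace (distr M borel (\<lambda>\<omega>. \<chi> i. X \<omega> $ i / b i))"
proof -
  interpret M: prob_space M by fact
  let ?E = "density lborel (exponential_density 1)" and ?Z = "std_normal_vec :: (real ^ 'n) measure"
  let ?Y = "normal_scale_mixture :: (real ^ 'n) measure"
  have X_borel [measurable]: "X \<in> borel_measurable M"
    using X by (simp add: symmetric_multivariate_laplace_def)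
  obtain A :: "real ^ 'n ^ 'n" where
    "distr M borel X = distr (?E \<Otimes>\<^sub>M ?Z) borel (\<lambda>(w, z). sqrt w *\<^sub>R (A *v z))"
    using X by (auto simp: symmetric_multivariate_laplace_def)
  moreover have A_borel [measurable]: "(*v) A \<in> borel_measurable borel"
    by (intro borel_measurable_continuous_onI linear_continuous_on)
       (simp add: matrix_vector_mul_bounded_linear)
  ultimately have distr_X: "distr M borel X = distr ?Y borel ((*v) A)"
    by (simp add: normal_scale_mixture_def distr_distr comp_def case_prod_unfold
        matrix_vector_mult_scaleR)
  have Y_rot: "rotation_invariant ?Y" and Y_pos: "positive_on_open ?Y"
    by (rule rotation_invariant_normal_scale_mixture positive_on_open_normal_scale_mixture)+
  have integral_X: "(\<integral>\<omega>. h (X \<omega>) \<partial>M) = (\<integral>y. h (A *v y) \<partial>?Y)"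
    and integrable_X: "integrable M (\<lambda>\<omega>. h (X \<omega>)) \<longleftrightarrow> integrable ?Y (\<lambda>y. h (A *v y))"
    if [measurable]: "h \<in> borel_measurable borel" for h :: "real ^ 'n \<Rightarrow> real"
    using arg_cong[OF distr_X, of "\<lambda>D. integral\<^sup>L D h"] arg_cong[OF distr_X, of "\<lambda>D. integrable D h"]
    by (simp_all add: integral_distr integrable_distr_eq)
  have square: "integrable ?Y (\<lambda>y. (A $ i \<bullet> y)\<^sup>2)" "(\<integral>y. (A $ i \<bullet> y)\<^sup>2 \<partial>?Y) = 2 * (b i)\<^sup>2" for i
    using laplace_second_moment[OF dist b, of i] integral_X[of "\<lambda>x. (x $ i)\<^sup>2"] integrable_X[of "\<lambda>x. (x $ i)\<^sup>2"]
    by (simp_all add: matrix_vector_mul_component)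
  \<comment> \<open>A zero row would give a coordinate with second moment 0 instead of
    \<open>2 * (b i)\<^sup>2\<close>.\<close>
  have A_nonzero: "A $ i \<noteq> 0" for i
    using square(2)[of i] b[of i] by auto
  obtain m where m: "\<And>u v. (\<integral>y. (u \<bullet> y) * (v \<bullet> y) \<partial>?Y) = m * (u \<bullet> v)"
    using rotation_invariant_second_moments[OF Y_rot A_nonzero square(1)] by blast
  have m_diag: "m * (A $ i \<bullet> A $ i) = 2 * (b i)\<^sup>2" for i
    using square(2)[of i] m[of "A $ i" "A $ i"] by (simp add: power2_eq_square)
  have m_pos: "0 < m"
  proof -
    fix i
    have "0 < m * (A $ i \<bullet> A $ i)" using b[of i] by (simp add: m_diag)
    then show ?thesis using A_nonzero[of i] inner_ge_zero[of "A $ i"]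
      by (simp add: zero_less_mult_iff del: inner_ge_zero)
  qed
  \<comment> \<open>The means vanish and the standard deviations are positive, so zero correlation
    says that the mixed moment \<open>m * (A $ i \<bullet> A $ j)\<close> is 0.\<close>
  have orth: "A $ i \<bullet> A $ j = 0" if "i \<noteq> j" for i j
  proof -
    have "(\<integral>\<omega>. X \<omega> $ i * X \<omega> $ j \<partial>M) = 0"
      using corr[OF that] b[of i] b[of j]
      by (simp add: corr_def laplace_mean[OF dist b] laplace_second_moment(2)[OF dist b])
    then show ?thesis
      using m[of "A $ i" "A $ j"] m_pos integral_X[of "\<lambda>x. x $ i * x $ j"]
      by (simp add: matrix_vector_mul_component)
  qed
  \<comment> \<open>By \<open>m_diag\<close> this is the constant for which row \<open>i\<close> of
    \<open>A\<close> has norm \<open>s * b i\<close>.\<close>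
  define s where "s = sqrt (2 / m)"
  have s: "0 < s" and s2: "s\<^sup>2 = 2 / m" using m_pos by (auto simp: s_def)
  define Q :: "real ^ 'n ^ 'n" where "Q = (\<chi> i. (1 / (s * b i)) *\<^sub>R A $ i)"
  have row_Q: "row i Q = (1 / (s * b i)) *\<^sub>R A $ i" for i
    by (simp add: row_def Q_def vec_eq_iff)
  have "orthogonal_matrix Q"
    unfolding orthogonal_matrix_orthonormal_rows
  proof (intro conjI allI impI)
    fix i
    have "A $ i \<bullet> A $ i = s\<^sup>2 * (b i)\<^sup>2"
      using m_diag[of i] m_pos by (simp add: s2 field_simps)
    then have "norm (A $ i) = s * b i"
      using s b[of i] by (simp add: norm_eq_sqrt_inner real_sqrt_mult)
    then show "norm (row i Q) = 1"
      using s b[of i] by (simp add: row_Q)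
  next
    fix i j :: 'n assume "i \<noteq> j"
    then show "orthogonal (row i Q) (row j Q)"
      by (simp add: row_Q orthogonal_def orth)
  qed
  then have Q: "orthogonal_transformation ((*v) Q)"
    by (simp add: orthogonal_transformation_matrix)
  have Q_borel [measurable]: "(*v) Q \<in> borel_measurable borel"
    by (rule borel_measurable_orthogonal_transformation[OF Q])
  define D :: "real ^ 'n \<Rightarrow> real ^ 'n" where "D = (\<lambda>x. \<chi> i. x $ i / b i)"
  have D_borel [measurable]: "D \<in> borel_measurable borel"
    using b unfolding D_def by (intro borel_measurable_continuous_onI continuous_intros) (auto simp: less_le)
  have D_A: "D (A *v y) = s *\<^sub>R (Q *v y)" for y
    using s b by (simp add: D_def Q_def vec_eq_iff matrix_vector_mul_component)
  have "distr M borel (\<lambda>\<omega>. D (X \<omega>)) = distr (distr M borel X) borel D"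
    by (simp add: distr_distr comp_def)
  also have "\<dots> = distr ?Y borel (\<lambda>y. s *\<^sub>R (Q *v y))"
    unfolding distr_X by (simp add: distr_distr comp_def D_A)
  also have "\<dots> = distr (distr ?Y borel ((*v) Q)) borel (\<lambda>y. s *\<^sub>R y)"
    by (simp add: distr_distr comp_def)
  also have "\<dots> = distr ?Y borel (\<lambda>y. s *\<^sub>R y)"
    using Y_rot Q by (simp add: rotation_invariant_def)
  finally have law: "distr M borel (\<lambda>\<omega>. D (X \<omega>)) = distr ?Y borel (\<lambda>y. s *\<^sub>R y)" .
  have DX_borel: "(\<lambda>\<omega>. D (X \<omega>)) \<in> borel_measurable M"
    by measurable
  have "spherical_laplace (distr M borel (\<lambda>\<omega>. D (X \<omega>)))"
  proof (intro spherical_laplace.intro spherical_laplace_axioms.intro)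
    show "prob_space (distr M borel (\<lambda>\<omega>. D (X \<omega>)))"
      by (rule M.prob_space_distr) simp
    show "rotation_invariant (distr M borel (\<lambda>\<omega>. D (X \<omega>)))"
      unfolding law by (rule rotation_invariant_scaleR[OF Y_rot])
    show "positive_on_open (distr M borel (\<lambda>\<omega>. D (X \<omega>)))"
      unfolding law using s by (intro positive_on_open_scaleR[OF Y_pos]) auto
    fix c :: real and i assume c: "0 \<le> c"
    have "measure (distr M borel (\<lambda>\<omega>. D (X \<omega>))) {t. c < t $ i} = measure M {\<omega> \<in> space M. c * b i < X \<omega> $ i}"
      using b by (subst measure_distr[OF DX_borel]) (auto simp: D_def field_simps intro!: arg_cong[where f = "measure M"])
    also have "\<dots> = exp (- c) / 2"
      using laplace_tail(1)[OF dist[of i] b, of "c * b i"] c b[of i] by simp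
    finally show "measure (distr M borel (\<lambda>\<omega>. D (X \<omega>))) {t. c < t $ i} = exp (- c) / 2" .
    have "measure (distr M borel (\<lambda>\<omega>. D (X \<omega>))) {t. c \<le> t $ i} = measure M {\<omega> \<in> space M. c * b i \<le> X \<omega> $ i}"
      using b by (subst measure_distr[OF DX_borel]) (auto simp: D_def field_simps intro!: arg_cong[where f = "measure M"])
    also have "\<dots> = exp (- c) / 2"
      using laplace_tail(2)[OF dist[of i] b, of "c * b i"] c b[of i] by simp
    finally show "measure (distr M borel (\<lambda>\<omega>. D (X \<omega>))) {t. c \<le> t $ i} = exp (- c) / 2" .
  qed
  then show ?thesis by (simp add: D_def)
qed

section \<open>Permutations and sign changes of the coordinates\<close>

lemma ex_bij_image_eq:
  fixes I J :: "'n::finite set"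
  assumes "card I = card J"
  obtains \<pi> :: "'n \<Rightarrow> 'n" where "bij \<pi>" "\<pi> ` I = J"
proof -
  have "card (- I) = card (- J)"
    using assms by (simp add: Compl_eq_Diff_UNIV card_Diff_subset)
  then obtain f g where f: "bij_betw f I J" and g: "bij_betw g (- I) (- J)"
    using assms finite_same_card_bij[of I J] finite_same_card_bij[of "- I" "- J"] by auto
  define \<pi> where "\<pi> x = (if x \<in> I then f x else g x)" for x
  have "bij_betw \<pi> (I \<union> - I) (J \<union> - J)"
    unfolding \<pi>_def using f g by (rule bij_betw_disjoint_Un) auto
  moreover have "\<pi> ` I = J"
    using f by (auto simp: \<pi>_def bij_betw_def)
  ultimately show ?thesis using that by simp
qed

text \<open>These are the rotations under which cubes and sectors go to cubes and sectors; through
  them rotation invariance yields equal probabilities.\<close>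

lemma orthogonal_transformation_signed_permutation:
  fixes \<pi> :: "'n::finite \<Rightarrow> 'n" and \<sigma> :: "'n \<Rightarrow> real"
  assumes \<pi>: "bij \<pi>" and \<sigma>: "\<And>i. \<sigma> i * \<sigma> i = 1"
  shows "orthogonal_transformation (\<lambda>t :: real ^ 'n. \<chi> i. \<sigma> i * t $ \<pi> i)"
  unfolding orthogonal_transformation_def
proof (intro conjI allI)
  show "linear (\<lambda>t :: real ^ 'n. \<chi> i. \<sigma> i * t $ \<pi> i)"
    by (intro linearI) (simp_all add: vec_eq_iff algebra_simps)
  fix v w :: "real ^ 'n"
  have "(\<chi> i. \<sigma> i * v $ \<pi> i) \<bullet> (\<chi> i. \<sigma> i * w $ \<pi> i) = (\<Sum>i\<in>UNIV. (\<sigma> i * \<sigma> i) * (v $ \<pi> i * w $ \<pi> i))"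
    unfolding inner_vec_def by (intro sum.cong) (simp_all add: algebra_simps)
  also have "\<dots> = (\<Sum>i\<in>UNIV. v $ \<pi> i * w $ \<pi> i)"
    by (simp add: \<sigma>)
  also have "\<dots> = v \<bullet> w"
    using sum.reindex_bij_betw[OF \<pi>, of "\<lambda>i. v $ i * w $ i"] by (simp add: inner_vec_def)
  finally show "(\<chi> i. \<sigma> i * v $ \<pi> i) \<bullet> (\<chi> i. \<sigma> i * w $ \<pi> i) = v \<bullet> w" .
qed

lemma axis_inner: "axis i 1 \<bullet> (t :: real ^ 'n) = t $ i"
  by (simp add: cart_eq_inner_axis inner_commute)

section \<open>Cubes and the sectors of the shells between them\<close>

definition cube :: "'n set \<Rightarrow> ereal \<Rightarrow> (real ^ 'n) set" where
  "cube I C = {t. \<forall>i\<in>I. ereal \<bar>t $ i\<bar> \<le> C}"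

lemma cube_borel [measurable]: "cube (I :: 'n::finite set) C \<in> sets borel"
proof -
  have "{t :: real ^ 'n \<in> space borel. \<forall>i\<in>I. ereal \<bar>t $ i\<bar> \<le> C} \<in> sets borel"
    by measurable
  then show ?thesis by (simp add: cube_def)
qed

lemma cube_mono: "C \<le> D \<Longrightarrow> cube I C \<subseteq> cube I D"
  by (auto simp: cube_def intro: order_trans)

text \<open>Ties are broken by the enumeration of the index type, so that the sectors below partition a shell
  exactly and not just up to null sets.\<close>

definition leads :: "'n set \<Rightarrow> ('n::countable \<Rightarrow> real) \<Rightarrow> 'n \<Rightarrow> bool" where
  "leads I t i \<longleftrightarrow> (\<forall>j\<in>I. \<bar>t j\<bar> < \<bar>t i\<bar> \<or> \<bar>t j\<bar> = \<bar>t i\<bar> \<and> to_nat i \<le> to_nat j)"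

lemma leads_unique: "leads I t i \<Longrightarrow> leads I t j \<Longrightarrow> i \<in> I \<Longrightarrow> j \<in> I \<Longrightarrow> i = j"
  by (fastforce simp: leads_def dest: injD[OF inj_to_nat])

text \<open>Among the indices of maximal modulus, collected in \<open>J\<close>, the one with the
  least code is taken.\<close>

lemma leads_exists:
  assumes "finite I" "I \<noteq> {}"
  obtains i where "i \<in> I" "leads I t i"
proof -
  define J where "J = {i \<in> I. \<forall>j\<in>I. \<bar>t j\<bar> \<le> \<bar>t i\<bar>}"
  have "\<exists>i\<in>I. \<forall>j\<in>I. \<bar>t j\<bar> \<le> \<bar>t i\<bar>"
    using assms Max_in[of "(\<lambda>i. \<bar>t i\<bar>) ` I"] Max_ge[of "(\<lambda>i. \<bar>t i\<bar>) ` I"] by fastforce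
  then have "J \<noteq> {}" by (auto simp: J_def)
  then obtain i where i: "i \<in> J" "\<And>j. j \<in> J \<Longrightarrow> to_nat i \<le> to_nat j"
    using exists_least_iff[of "\<lambda>n. \<exists>i\<in>J. to_nat i = n"] by (metis all_not_in_conv not_le)
  have "leads I t i"
    unfolding leads_def
  proof
    fix j assume "j \<in> I"
    show "\<bar>t j\<bar> < \<bar>t i\<bar> \<or> \<bar>t j\<bar> = \<bar>t i\<bar> \<and> to_nat i \<le> to_nat j"
    proof (cases "\<bar>t j\<bar> = \<bar>t i\<bar>")
      case True
      then have "j \<in> J" using i(1) \<open>j \<in> I\<close> by (simp add: J_def)
      with True i(2) show ?thesis by simp
    next
      case False
      then show ?thesis using i(1) \<open>j \<in> I\<close> by (force simp: J_def)
    qed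
  qed
  with i(1) show ?thesis by (auto simp: J_def intro: that)
qed

text \<open>In standardized coordinates, this is the piece of the shell charged to the upper
  (\<open>s\<close> true) or lower side \<open>i\<close>. The outer bound \<open>C\<close> may be
  infinite, because the first stage cuts the whole space.\<close>

definition sector :: "'n::countable set \<Rightarrow> real \<Rightarrow> ereal \<Rightarrow> 'n \<times> bool \<Rightarrow> ('n \<Rightarrow> real) set" where
  "sector I c C = (\<lambda>(i, s). {t. (\<forall>j\<in>I. ereal \<bar>t j\<bar> \<le> C) \<and> leads I t i \<and> (if s then c < t i else t i < - c)})"

text \<open>The leading index is unique, and for \<open>0 \<le> c\<close> its coordinate cannot lie
  beyond both faces.\<close>

lemma disjoint_family_sector:
  assumes "0 \<le> c"
  shows "disjoint_family_on (sector I c C) (I \<times> UNIV)"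
  unfolding disjoint_family_on_def
proof (intro ballI impI)
  fix k k' assume k: "k \<in> I \<times> (UNIV :: bool set)" "k' \<in> I \<times> UNIV" "k \<noteq> k'"
  show "sector I c C k \<inter> sector I c C k' = {}"
  proof (rule ccontr)
    assume "sector I c C k \<inter> sector I c C k' \<noteq> {}"
    then obtain t where t: "t \<in> sector I c C k" "t \<in> sector I c C k'" by blast
    then have "fst k = fst k'"
      using k leads_unique[of I t "fst k" "fst k'"] by (auto simp: sector_def)
    then have "snd k \<noteq> snd k'" using k by (auto simp: prod_eq_iff)
    with t \<open>fst k = fst k'\<close> show False
      using assms by (auto simp: sector_def split: prod.splits if_splits)
  qed
qed

text \<open>If some coordinate exceeds \<open>c\<close> in modulus, so does the leading one, and its
  sign selects the sector.\<close>

lemma sector_cover: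
  assumes "finite I" "I \<noteq> {}"
  shows "(\<Union>k\<in>I \<times> (UNIV :: bool set). sector I c C k) =
    {t. (\<forall>i\<in>I. ereal \<bar>t i\<bar> \<le> C) \<and> \<not> (\<forall>i\<in>I. \<bar>t i\<bar> \<le> c)}" (is "?U = ?S")
proof (intro Set.set_eqI iffI)
  fix t assume "t \<in> ?U"
  then show "t \<in> ?S" by (fastforce simp: sector_def split: if_splits)
next
  fix t assume t: "t \<in> ?S"
  obtain i where i: "i \<in> I" "leads I t i" using leads_exists[OF assms] by blast
  obtain j where "j \<in> I" "c < \<bar>t j\<bar>" using t by force
  then have "c < \<bar>t i\<bar>" using i by (fastforce simp: leads_def)
  then have "t \<in> sector I c C (i, 0 < t i)"
    using t i by (auto simp: sector_def)
  then show "t \<in> ?U" using i by blast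
qed

section \<open>Probabilities of half-spaces and cubes\<close>

context spherical_laplace
begin

lemma sets_N [measurable_cong, simp]: "sets N = sets borel"
  using rotation_invariant by (simp add: rotation_invariant_def)

lemma space_N [simp]: "space N = UNIV"
  using sets_eq_imp_space_eq[OF sets_N] by simp

lemma prob_orthogonal_vimage:
  assumes f: "orthogonal_transformation f" and [measurable]: "S \<in> sets borel"
  shows "prob (f -` S) = prob S"
proof -
  have [measurable]: "f \<in> borel_measurable borel"
    by (rule borel_measurable_orthogonal_transformation[OF f])
  have "prob S = measure (distr N borel f) S"
    using rotation_invariant f by (simp add: rotation_invariant_def)
  also have "\<dots> = prob (f -` S)"
    by (subst measure_distr) auto
  finally show ?thesis by simp
qed

lemma prob_component_eq_0: "prob {t. t $ i = 0} = 0"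
proof -
  have "prob ({t. 0 \<le> t $ i} - {t. 0 < t $ i}) = 0"
    by (subst finite_measure_Diff) (auto simp: prob_tail)
  moreover have "{t. 0 \<le> t $ i} - {t :: real ^ 'n. 0 < t $ i} = {t. t $ i = 0}" by auto
  ultimately show ?thesis by simp
qed

text \<open>A rotation takes the hyperplane orthogonal to \<open>v\<close> to a coordinate
  hyperplane, which is null because the strict and non-strict tails at 0 agree.\<close>

lemma AE_inner_nonzero:
  assumes v: "v \<noteq> 0"
  shows "AE t in N. v \<bullet> t \<noteq> 0"
proof -
  fix i :: 'n
  let ?h = "indicator {0} :: real \<Rightarrow> real"
  have "(\<integral>t. ?h (v \<bullet> t) \<partial>N) = (\<integral>t. ?h ((norm v *\<^sub>R axis i 1) \<bullet> t) \<partial>N)"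
    by (rule rotation_invariant_integral_inner[OF rotation_invariant]) auto
  also have "(\<lambda>t :: real ^ 'n. ?h ((norm v *\<^sub>R axis i 1) \<bullet> t)) = indicator {t. t $ i = 0}"
    using v by (auto simp: fun_eq_iff indicator_def axis_inner)
  also have "(\<integral>t. indicator {t. t $ i = 0} t \<partial>N) = (0 :: real)"
    by (simp add: prob_component_eq_0)
  also have "(\<lambda>t. ?h (v \<bullet> t)) = indicator {t. v \<bullet> t = 0}"
    by (auto simp: fun_eq_iff indicator_def)
  finally have "prob {t. v \<bullet> t = 0} = 0" by simp
  then show ?thesis
    by (intro AE_I[of _ _ "{t. v \<bullet> t = 0}"]) (auto simp: emeasure_eq_measure)
qed

text \<open>Ties in modulus lie on the two hyperplanes orthogonal to the difference and the sum of
  the axis vectors.\<close>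

lemma AE_abs_component_neq:
  assumes "i \<noteq> j"
  shows "AE t in N. \<bar>t $ i\<bar> \<noteq> \<bar>t $ j\<bar>"
proof -
  have "axis i (1::real) - axis j 1 \<noteq> 0" "axis i (1::real) + axis j 1 \<noteq> 0"
    using assms by (auto simp: vec_eq_iff axis_def)
  from this[THEN AE_inner_nonzero] show ?thesis
    by eventually_elim (auto simp: inner_simps axis_inner abs_if split: if_splits)
qed

text \<open>The law is invariant under reflection in the origin, so the mean is its own
  negative.\<close>

lemma mean_component: "(\<integral>t. t $ i \<partial>N) = 0"
proof -
  have "(\<integral>t. axis i 1 \<bullet> t \<partial>N) = (\<integral>t. (- axis i 1) \<bullet> t \<partial>N)"
    using rotation_invariant_integral_inner(2)[OF rotation_invariant, of "axis i 1" "- axis i 1" "\<lambda>x. x"] by simp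
  then show ?thesis by (simp add: axis_inner)
qed

lemma prob_le:
  "prob {t. t $ i \<le> x} = (if 0 \<le> x then 1 - exp (- x) / 2 else exp x / 2)"
proof (cases "0 \<le> x")
  case True
  have "prob {t. t $ i \<le> x} = prob (space N - {t. x < t $ i})"
    by (rule arg_cong[where f = prob]) auto
  also have "\<dots> = 1 - exp (- x) / 2"
    using True by (subst prob_compl) (auto simp: prob_tail)
  finally show ?thesis using True by simp
next
  case False
  have "orthogonal_transformation (\<lambda>t :: real ^ 'n. \<chi> i. - 1 * t $ id i)"
    by (rule orthogonal_transformation_signed_permutation[OF bij_id]) simp
  from prob_orthogonal_vimage[OF this, of "{t. - x \<le> t $ i}"] False show ?thesis
    by (simp add: prob_tail vimage_def le_minus_iff minus_le_iff)
qed

lemma prob_abs_le: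
  assumes "0 \<le> x"
  shows "prob {t. \<bar>t $ i\<bar> \<le> x} = 1 - exp (- x)"
proof -
  have "orthogonal_transformation (\<lambda>t :: real ^ 'n. \<chi> i. - 1 * t $ id i)"
    by (rule orthogonal_transformation_signed_permutation[OF bij_id]) simp
  from prob_orthogonal_vimage[OF this, of "{t. x < t $ i}"] assms
  have lower: "prob {t. x < - t $ i} = exp (- x) / 2"
    by (simp add: prob_tail vimage_def)
  have "{t. \<bar>t $ i\<bar> \<le> x} = {t. t $ i \<le> x} - {t. x < - t $ i}"
    by auto
  moreover have "prob ({t. t $ i \<le> x} - {t. x < - t $ i}) = prob {t. t $ i \<le> x} - prob {t. x < - t $ i}"
    using assms by (intro finite_measure_Diff) auto
  ultimately show ?thesis
    using assms by (simp add: prob_le lower)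
qed

text \<open>A permutation of the coordinates taking \<open>I\<close> onto \<open>J\<close> takes one
  cube to the other. This is why a single half-width serves all projections.\<close>

lemma prob_cube_card_eq:
  assumes "card I = card J"
  shows "prob (cube I C) = prob (cube J C)"
proof -
  obtain \<pi> where \<pi>: "bij \<pi>" "\<pi> ` I = J" using ex_bij_image_eq[OF assms] .
  have "orthogonal_transformation (\<lambda>t :: real ^ 'n. \<chi> i. 1 * t $ \<pi> i)"
    by (rule orthogonal_transformation_signed_permutation[OF \<pi>(1)]) simp
  from prob_orthogonal_vimage[OF this, of "cube I C"] show ?thesis
    by (simp add: cube_def vimage_def \<pi>(2)[symmetric])
qed

text \<open>The difference of the two cubes contains a nonempty open box, which has positive
  probability. All coordinates are confined in \<open>U\<close>, not only those in
  \<open>I\<close>.\<close>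

lemma prob_cube_strict_mono:
  assumes "I \<noteq> {}" "0 \<le> c" "c < d"
  shows "prob (cube I (ereal c)) < prob (cube I (ereal d))"
proof -
  define U where "U = {t :: real ^ 'n. \<forall>i. c < t $ i \<and> t $ i < d}"
  have "U = box (\<chi> i. c) (\<chi> i. d)"
    by (auto simp: U_def box_def Basis_vec_def inner_axis)
  then have "open U" by (simp only: open_box)
  moreover have "(\<chi> i. (c + d) / 2) \<in> U" using assms by (simp add: U_def)
  ultimately have U: "U \<in> sets N" "0 < prob U"
    using positive_on_open unfolding positive_on_open_def
    by (auto simp: emeasure_eq_measure less_le)
  have "U \<subseteq> cube I (ereal d) - cube I (ereal c)"
  proof
    fix t assume "t \<in> U"
    then have "c < t $ i \<and> t $ i < d" for i by (simp add: U_def)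
    then have bounds: "\<bar>t $ i\<bar> \<le> d" "c < \<bar>t $ i\<bar>" for i
      using assms by (smt (verit))+
    obtain i where "i \<in> I" using assms by blast
    then show "t \<in> cube I (ereal d) - cube I (ereal c)"
      using bounds by (auto simp: cube_def not_le intro!: bexI[of _ i])
  qed
  then have "prob U \<le> prob (cube I (ereal d) - cube I (ereal c))"
    by (intro finite_measure_mono) auto
  also have "\<dots> = prob (cube I (ereal d)) - prob (cube I (ereal c))"
    using assms by (intro finite_measure_Diff cube_mono) auto
  finally show ?thesis using U by simp
qed

lemma prob_cube_inj:
  assumes "I \<noteq> {}" "0 \<le> c" "0 \<le> d" "prob (cube I (ereal c)) = prob (cube I (ereal d))"
  shows "c = d"
  using prob_cube_strict_mono[of I c d] prob_cube_strict_mono[of I d c] assms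
  by (cases c d rule: linorder_cases) auto

text \<open>A point of the shell has some coordinate between \<open>c\<close> and \<open>d\<close>
  in modulus, so a union bound applies. The estimate serves to prove continuity in the
  half-width.\<close>

lemma prob_cube_diff_le:
  assumes "0 \<le> c" "c \<le> d"
  shows "prob (cube I (ereal d)) - prob (cube I (ereal c)) \<le> card I * (exp (- c) - exp (- d))"
proof -
  have "prob (cube I (ereal d)) - prob (cube I (ereal c)) = prob (cube I (ereal d) - cube I (ereal c))"
    using assms by (intro finite_measure_Diff[symmetric] cube_mono) auto
  also have "\<dots> \<le> prob (\<Union>i\<in>I. {t. \<bar>t $ i\<bar> \<le> d} - {t. \<bar>t $ i\<bar> \<le> c})"
    by (intro finite_measure_mono) (auto simp: cube_def)
  also have "\<dots> \<le> (\<Sum>i\<in>I. prob ({t. \<bar>t $ i\<bar> \<le> d} - {t. \<bar>t $ i\<bar> \<le> c}))"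
    by (intro finite_measure_subadditive_finite) auto
  also have "\<dots> = (\<Sum>i\<in>I. exp (- c) - exp (- d))"
  proof (rule sum.cong)
    fix i
    have "prob ({t. \<bar>t $ i\<bar> \<le> d} - {t. \<bar>t $ i\<bar> \<le> c}) = prob {t. \<bar>t $ i\<bar> \<le> d} - prob {t. \<bar>t $ i\<bar> \<le> c}"
      using assms by (intro finite_measure_Diff) auto
    then show "prob ({t. \<bar>t $ i\<bar> \<le> d} - {t. \<bar>t $ i\<bar> \<le> c}) = exp (- c) - exp (- d)"
      using assms by (simp add: prob_abs_le)
  qed simp
  finally show ?thesis by simp
qed

lemma prob_cube_infinity [simp]: "prob (cube I \<infinity>) = 1"
  using prob_space by (simp add: cube_def)

lemma prob_cube_zero: "I \<noteq> {} \<Longrightarrow> prob (cube I (ereal 0)) = 0"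
proof -
  assume "I \<noteq> {}"
  then obtain i where "i \<in> I" by blast
  then have "prob (cube I (ereal 0)) \<le> prob {t. \<bar>t $ i\<bar> \<le> 0}"
    by (intro finite_measure_mono) (auto simp: cube_def)
  also have "\<dots> = 0" using prob_abs_le[of 0 i] by simp
  finally show ?thesis by (simp add: measure_le_0_iff)
qed

text \<open>A union bound for the complement; it shows that the probability tends to 1.\<close>

lemma prob_cube_ge:
  assumes "0 \<le> c"
  shows "1 - card I * exp (- c) \<le> prob (cube I (ereal c))"
proof -
  have "prob (space N - cube I (ereal c)) \<le> prob (\<Union>i\<in>I. space N - {t. \<bar>t $ i\<bar> \<le> c})"
    by (intro finite_measure_mono sets.finite_UN) (auto simp: cube_def)
  also have "\<dots> \<le> (\<Sum>i\<in>I. prob (space N - {t. \<bar>t $ i\<bar> \<le> c}))"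
    by (intro finite_measure_subadditive_finite) auto
  also have "\<dots> = (\<Sum>i\<in>I. exp (- c))"
  proof (rule sum.cong)
    fix i
    show "prob (space N - {t. \<bar>t $ i\<bar> \<le> c}) = exp (- c)"
      using assms by (subst prob_compl) (auto simp: prob_abs_le)
  qed simp
  also have "prob (space N - cube I (ereal c)) = 1 - prob (cube I (ereal c))"
    by (rule prob_compl) simp
  finally show ?thesis by simp
qed

text \<open>Intermediate value theorem: the probability is continuous in the half-width, is 0 at 0,
  and exceeds \<open>q\<close> at a large \<open>K\<close>.\<close>

lemma prob_cube_surj:
  assumes I: "I \<noteq> {}" and q: "0 < q" "q < 1"
  obtains c where "0 < c" "prob (cube I (ereal c)) = q"
proof -
  define G where "G c = prob (cube I (ereal c))" for c
  have mono: "G c \<le> G d" if "c \<le> d" for c d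
    unfolding G_def using that by (intro finite_measure_mono cube_mono) auto
  have G_dist: "\<bar>G d - G c\<bar> \<le> card I * \<bar>exp (- d) - exp (- c)\<bar>" if "0 \<le> c" "0 \<le> d" for c d
  proof (cases "c \<le> d")
    case True
    then show ?thesis
      using mono[OF True] prob_cube_diff_le[of c d I] that by (simp add: G_def abs_if)
  next
    case False
    then show ?thesis
      using mono[of d c] prob_cube_diff_le[of d c I] that by (simp add: G_def abs_if)
  qed
  have cont: "continuous_on {0..K} G" for K
    unfolding continuous_on_def
  proof
    fix c assume c: "c \<in> {0..K}"
    have "((\<lambda>d. card I * \<bar>exp (- d) - exp (- c)\<bar>) \<longlongrightarrow> card I * \<bar>exp (- c) - exp (- c)\<bar>) (at c within {0..K})"
      by (intro tendsto_intros)
    then have "((\<lambda>d. card I * \<bar>exp (- d) - exp (- c)\<bar>) \<longlongrightarrow> 0) (at c within {0..K})"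
      by simp
    moreover have "\<forall>\<^sub>F d in at c within {0..K}. norm (G d - G c) \<le> card I * \<bar>exp (- d) - exp (- c)\<bar>"
      using c G_dist by (auto simp: eventually_at_filter)
    ultimately have "((\<lambda>d. G d - G c) \<longlongrightarrow> 0) (at c within {0..K})"
      by (rule Lim_null_comparison[rotated])
    then show "(G \<longlongrightarrow> G c) (at c within {0..K})"
      by (rule LIM_zero_cancel)
  qed
  have "((\<lambda>c :: real. exp (- c)) \<longlongrightarrow> 0) at_top"
    by real_asymp
  from tendsto_diff[OF tendsto_const tendsto_mult[OF tendsto_const this], of 1 "real (card I)"]
  have "\<forall>\<^sub>F c in at_top. q < 1 - card I * exp (- c)"
    using q by (intro order_tendstoD) auto
  then obtain K where K: "0 \<le> K" "q < 1 - card I * exp (- K)"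
    using eventually_happens'[OF _ eventually_conj[OF _ eventually_ge_at_top[of "0::real"]]]
    by (metis trivial_limit_at_top_linorder)
  have "G 0 \<le> q" "q \<le> G K"
    using I q K prob_cube_ge[of K I] by (auto simp: G_def prob_cube_zero)
  then obtain c where c: "0 \<le> c" "G c = q"
    using IVT'[of G 0 q K] cont K by auto
  moreover have "c \<noteq> 0" using c q prob_cube_zero[OF I] by (auto simp: G_def)
  ultimately show ?thesis by (intro that[of c]) (auto simp: G_def)
qed

end

lemma sets_sector_vec [measurable]:
  "{t :: real ^ 'n::finite. ($) t \<in> sector I c C k} \<in> sets borel"
proof -
  obtain i s where k: "k = (i, s)" by fastforce
  have "{t :: real ^ 'n \<in> space borel. ($) t \<in> sector I c C (i, s)} \<in> sets borel"
    unfolding sector_def leads_def by simp measurable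
  then show ?thesis by (simp add: k)
qed

section \<open>Equal probabilities of the sectors\<close>

context spherical_laplace
begin

text \<open>Transposing \<open>i\<close> and \<open>j\<close>, with a global change of sign if the
  sides differ, maps one sector to the other up to ties, and ties are null.\<close>

lemma prob_sector_eq:
  assumes "i \<in> I" "j \<in> I"
  shows "prob {t. ($) t \<in> sector I c C (i, s)} = prob {t. ($) t \<in> sector I c C (j, s')}"
proof -
  \<comment> \<open>The tie-breaking by \<open>to_nat\<close> is not symmetric under permutations,
    so it is replaced by strict inequalities.\<close>
  define S where "S i s = {t :: real ^ 'n. (\<forall>j\<in>I. ereal \<bar>t $ j\<bar> \<le> C) \<and>
    (\<forall>j\<in>I - {i}. \<bar>t $ j\<bar> < \<bar>t $ i\<bar>) \<and> (if s then c < t $ i else t $ i < - c)}" for i and s :: bool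
  have S_borel [measurable]: "S i s \<in> sets borel" for i s
  proof -
    have "{t :: real ^ 'n \<in> space borel. (\<forall>j\<in>I. ereal \<bar>t $ j\<bar> \<le> C) \<and>
        (\<forall>j\<in>I - {i}. \<bar>t $ j\<bar> < \<bar>t $ i\<bar>) \<and> (if s then c < t $ i else t $ i < - c)} \<in> sets borel"
      by measurable
    then show ?thesis by (simp add: S_def)
  qed
  have no_ties: "prob {t. ($) t \<in> sector I c C (i, s)} = prob (S i s)" for i s
  proof (rule measure_eq_AE)
    have "AE t in N. \<forall>j\<in>I - {i}. \<bar>t $ i\<bar> \<noteq> \<bar>t $ j\<bar>"
      by (intro AE_finite_allI AE_abs_component_neq) auto
    then show "AE t in N. t \<in> {t. ($) t \<in> sector I c C (i, s)} \<longleftrightarrow> t \<in> S i s"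
    proof eventually_elim
      case (elim t)
      then have "(\<bar>t $ j\<bar> < \<bar>t $ i\<bar> \<or> \<bar>t $ j\<bar> = \<bar>t $ i\<bar> \<and> to_nat i \<le> to_nat j) \<longleftrightarrow>
          (j \<noteq> i \<longrightarrow> \<bar>t $ j\<bar> < \<bar>t $ i\<bar>)" if "j \<in> I" for j
      proof (cases "j = i")
        case False
        then have "\<bar>t $ j\<bar> \<noteq> \<bar>t $ i\<bar>" using elim that by (metis DiffI singletonD)
        then show ?thesis using False by simp
      qed simp
      then have "leads I (($) t) i \<longleftrightarrow> (\<forall>j\<in>I - {i}. \<bar>t $ j\<bar> < \<bar>t $ i\<bar>)"
        by (auto simp: leads_def)
      then show ?case by (simp add: sector_def S_def)
    qed
  qed auto
  \<comment> \<open>The sign is applied to every coordinate; moduli are unaffected, and upper and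
    lower sides are exchanged exactly when \<open>s\<close> and \<open>s'\<close> differ.\<close>
  define e :: real where "e = (if s = s' then 1 else - 1)"
  let ?\<pi> = "Transposition.transpose i j"
  have e: "e * e = 1" "\<bar>e * x\<bar> = \<bar>x\<bar>" for x
    by (simp_all add: e_def)
  have \<pi>_image: "?\<pi> ` I = I" "?\<pi> ` (I - {j}) = I - {i}"
    using assms by (simp_all add: transpose_image_eq image_set_diff)
  have f: "orthogonal_transformation (\<lambda>t :: real ^ 'n. \<chi> k. e * t $ ?\<pi> k)"
    by (rule orthogonal_transformation_signed_permutation) (simp_all add: e)
  have "(\<chi> k. e * t $ ?\<pi> k) \<in> S j s' \<longleftrightarrow> t \<in> S i s" for t
  proof -
    have "(\<forall>k\<in>I. ereal \<bar>t $ ?\<pi> k\<bar> \<le> C) \<longleftrightarrow> (\<forall>k\<in>?\<pi> ` I. ereal \<bar>t $ k\<bar> \<le> C)"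
      by simp
    moreover have "(\<forall>k\<in>I - {j}. \<bar>t $ ?\<pi> k\<bar> < \<bar>t $ i\<bar>) \<longleftrightarrow> (\<forall>k\<in>?\<pi> ` (I - {j}). \<bar>t $ k\<bar> < \<bar>t $ i\<bar>)"
      by simp
    ultimately show ?thesis
      unfolding \<pi>_image by (auto simp: S_def e e_def)
  qed
  then have "(\<lambda>t. \<chi> k. e * t $ ?\<pi> k) -` S j s' = S i s" by auto
  then show ?thesis
    using prob_orthogonal_vimage[OF f S_borel, of j s'] by (simp add: no_ties)
qed

text \<open>The \<open>2 * card I\<close> sectors partition the shell and are equally
  likely.\<close>

lemma prob_sector:
  assumes c: "0 \<le> c" "ereal c \<le> C" and i: "i \<in> I"
  shows "prob {t. ($) t \<in> sector I c C (i, s)} = (prob (cube I C) - prob (cube I (ereal c))) / (2 * card I)"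
proof -
  let ?S = "\<lambda>k. {t :: real ^ 'n. ($) t \<in> sector I c C k}"
  have "cube I C - cube I (ereal c) = (\<Union>k\<in>I \<times> UNIV. ?S k)"
  proof -
    have "(\<Union>k\<in>I \<times> UNIV. ?S k) = {t. ($) t \<in> (\<Union>k\<in>I \<times> UNIV. sector I c C k)}" by auto
    also have "\<dots> = cube I C - cube I (ereal c)"
      using i by (subst sector_cover) (auto simp: cube_def)
    finally show ?thesis ..
  qed
  moreover have "prob (\<Union>k\<in>I \<times> UNIV. ?S k) = (\<Sum>k\<in>I \<times> UNIV. prob (?S k))"
  proof (rule finite_measure_finite_Union)
    show "disjoint_family_on ?S (I \<times> UNIV)"
      unfolding disjoint_family_on_def
    proof (intro ballI impI)
      fix k k' assume "k \<in> I \<times> (UNIV :: bool set)" "k' \<in> I \<times> (UNIV :: bool set)" "k \<noteq> k'"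
      then have "sector I c C k \<inter> sector I c C k' = {}"
        by (rule disjoint_family_onD[OF disjoint_family_sector[OF c(1)]])
      then show "?S k \<inter> ?S k' = {}" by auto
    qed
  qed auto
  moreover have "\<dots> = (\<Sum>k\<in>I \<times> (UNIV :: bool set). prob (?S (i, s)))"
    using i by (intro sum.cong) (auto intro: prob_sector_eq)
  moreover have "prob (cube I C - cube I (ereal c)) = prob (cube I C) - prob (cube I (ereal c))"
    using c by (intro finite_measure_Diff cube_mono) auto
  ultimately have "prob (cube I C) - prob (cube I (ereal c)) = prob (?S (i, s)) * real (2 * card I)"
    by (simp add: card_cartesian_product mult_ac)
  moreover have "real (2 * card I) \<noteq> 0" using i by auto
  ultimately show ?thesis by (metis nonzero_mult_div_cancel_right)
qed

end

section \<open>Boxes and the loss of probability in one stage\<close>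

lemma box_on_cong:
  "(\<And>i. i \<in> I \<Longrightarrow> l i = l' i) \<Longrightarrow> (\<And>i. i \<in> I \<Longrightarrow> u i = u' i) \<Longrightarrow> box_on I l u = box_on I l' u'"
  by (auto simp: box_on_def)

lemma box_on_mono:
  "(\<And>i. i \<in> I \<Longrightarrow> l i \<le> l' i) \<Longrightarrow> (\<And>i. i \<in> I \<Longrightarrow> u' i \<le> u i) \<Longrightarrow> box_on I l' u' \<subseteq> box_on I l u"
  unfolding box_on_def by (blast intro: order_trans)

lemma sets_box_on:
  assumes "finite I"
  shows "box_on I l u \<in> sets (Pi\<^sub>M I (\<lambda>_. borel))"
proof -
  have "{x \<in> space (Pi\<^sub>M I (\<lambda>_. borel)). \<forall>i\<in>I. l i \<le> ereal (x i) \<and> ereal (x i) \<le> u i} \<in> sets (Pi\<^sub>M I (\<lambda>_. borel))"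
    using assms by measurable
  then show ?thesis by (simp add: box_on_def space_PiM)
qed

text \<open>The pieces are disjoint with union the removed set, so the removed proportion is
  \<open>2 * card I\<close> times \<open>\<alpha> / (2 * card I)\<close>.\<close>

lemma measure_peeling_stage:
  assumes Q: "finite_measure Q" "sets Q = sets (Pi\<^sub>M I (\<lambda>_. borel))"
    and I: "finite I" "I \<noteq> {}"
    and stage: "peeling_stage Q I \<alpha> l u l' u'"
  shows "measure Q (box_on I l' u') = (1 - \<alpha>) * measure Q (box_on I l u)"
proof -
  interpret Q: finite_measure Q by fact
  obtain R :: "'a \<times> bool \<Rightarrow> ('a \<Rightarrow> real) set" where
    R: "disjoint_family_on R (I \<times> UNIV)" "(\<Union>k\<in>I \<times> UNIV. R k) = box_on I l u - box_on I l' u'"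
      "\<forall>k\<in>I \<times> UNIV. R k \<in> sets Q \<and> measure Q (R k) = \<alpha> / (2 * real (card I)) * measure Q (box_on I l u)"
    using stage unfolding peeling_stage_def by (elim conjE exE) (rule that)
  have sub: "box_on I l' u' \<subseteq> box_on I l u"
    using stage by (intro box_on_mono) (auto simp: peeling_stage_def)
  have "measure Q (box_on I l u) - measure Q (box_on I l' u') = measure Q (\<Union>k\<in>I \<times> UNIV. R k)"
    using sub sets_box_on[OF I(1)] Q(2) unfolding R(2) by (subst Q.finite_measure_Diff) auto
  also have "\<dots> = (\<Sum>k\<in>I \<times> UNIV. measure Q (R k))"
    using R I by (intro Q.finite_measure_finite_Union) auto
  also have "\<dots> = \<alpha> * measure Q (box_on I l u)"
    using I by (simp add: R(3) card_cartesian_product card_gt_0_iff)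
  finally show ?thesis by (simp add: algebra_simps)
qed

section \<open>Boxes produced by fastPRIM\<close>

text \<open>\<open>C\<close> is the common half-width after coordinate \<open>i\<close> is divided
  by \<open>b i\<close>. For positive scales, \<open>C = \<infinity>\<close> gives the whole
  space.\<close>

definition sym_box :: "('n \<Rightarrow> real) \<Rightarrow> 'n set \<Rightarrow> ereal \<Rightarrow> ('n \<Rightarrow> real) set" where
  "sym_box b I C = box_on I (\<lambda>i. - (C * ereal (b i))) (\<lambda>i. C * ereal (b i))"

lemma mem_sym_box:
  assumes "\<And>i. 0 < b i"
  shows "x \<in> sym_box b I C \<longleftrightarrow> x \<in> I \<rightarrow>\<^sub>E UNIV \<and> (\<forall>i\<in>I. ereal \<bar>x i / b i\<bar> \<le> C)"
proof -
  have "- (C * ereal (b i)) \<le> ereal (x i) \<and> ereal (x i) \<le> C * ereal (b i) \<longleftrightarrow> ereal \<bar>x i / b i\<bar> \<le> C" for i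
  proof (cases C)
    case (real r)
    have "- (r * b i) \<le> x i \<and> x i \<le> r * b i \<longleftrightarrow> \<bar>x i\<bar> \<le> r * b i" by auto
    also have "\<dots> \<longleftrightarrow> \<bar>x i / b i\<bar> \<le> r"
      using assms[of i] by (simp add: abs_divide pos_divide_le_eq)
    finally show ?thesis using real by simp
  qed (use assms[of i] in auto)
  then show ?thesis by (simp add: sym_box_def box_on_def)
qed

lemma sector_cong:
  assumes "\<And>j. j \<in> I \<Longrightarrow> t j = t' j" "i \<in> I"
  shows "t \<in> sector I c C (i, s) \<longleftrightarrow> t' \<in> sector I c C (i, s)"
  using assms by (simp add: sector_def leads_def)

lemma sets_sector_PiM:
  assumes I: "finite I" and i: "i \<in> I"
  shows "{x \<in> space (Pi\<^sub>M I (\<lambda>_. borel)). (\<lambda>i. x i / b i) \<in> sector I c C (i, s)} \<in> sets (Pi\<^sub>M I (\<lambda>_. borel))"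
proof -
  let ?P = "Pi\<^sub>M I (\<lambda>_. borel :: real measure)"
  have comp: "(\<lambda>x. x j / b j) \<in> borel_measurable ?P" if "j \<in> I" for j
    by (intro borel_measurable_divide measurable_component_singleton[OF that] borel_measurable_const)
  have le: "Measurable.pred ?P (\<lambda>x. ereal \<bar>f x\<bar> \<le> C)"
    and lead: "Measurable.pred ?P (\<lambda>x. \<bar>f x\<bar> < \<bar>g x\<bar> \<or> \<bar>f x\<bar> = \<bar>g x\<bar> \<and> m \<le> n)"
    and sign: "Measurable.pred ?P (\<lambda>x. if s then c < g x else g x < - c)"
    if [measurable]: "f \<in> borel_measurable ?P" "g \<in> borel_measurable ?P" for f g and m n :: nat
  proof -
    show "Measurable.pred ?P (\<lambda>x. ereal \<bar>f x\<bar> \<le> C)" by measurable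
    have [measurable]: "Measurable.pred ?P (\<lambda>x. \<bar>f x\<bar> < \<bar>g x\<bar>)" "Measurable.pred ?P (\<lambda>x. \<bar>f x\<bar> = \<bar>g x\<bar>)"
      using borel_measurable_eq[of "\<lambda>x. \<bar>f x\<bar>" ?P "\<lambda>x. \<bar>g x\<bar>"] by (simp_all add: pred_def)
    show "Measurable.pred ?P (\<lambda>x. \<bar>f x\<bar> < \<bar>g x\<bar> \<or> \<bar>f x\<bar> = \<bar>g x\<bar> \<and> m \<le> n)" by measurable
    show "Measurable.pred ?P (\<lambda>x. if s then c < g x else g x < - c)" by (cases s) simp_all
  qed
  have "Measurable.pred ?P (\<lambda>x. (\<lambda>i. x i / b i) \<in> sector I c C (i, s))"
    unfolding sector_def leads_def case_prod_conv mem_Collect_eq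
    by (intro pred_intros_logic(3) pred_intros_finite I le[OF comp comp[OF i]] lead sign[OF comp[OF i] comp[OF i]] comp i)
  then show ?thesis by (simp add: pred_def)
qed

context spherical_laplace
begin

text \<open>Undoing the standardization: when \<open>N\<close> is the law of the vector
  \<open>X i / b i\<close>, this is the law of the projection of \<open>X\<close> onto
  \<open>I\<close>.\<close>

definition scaled_law :: "('n \<Rightarrow> real) \<Rightarrow> 'n set \<Rightarrow> ('n \<Rightarrow> real) measure" where
  "scaled_law b I = distr N (Pi\<^sub>M I (\<lambda>_. borel)) (\<lambda>t. \<lambda>i\<in>I. b i * t $ i)"

lemma sets_scaled_law: "sets (scaled_law b I) = sets (Pi\<^sub>M I (\<lambda>_. borel))"
  by (simp add: scaled_law_def)

lemma space_scaled_law: "space (scaled_law b I) = I \<rightarrow>\<^sub>E UNIV"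
  by (simp add: scaled_law_def space_PiM)

lemma scale_measurable [measurable]: "(\<lambda>t. \<lambda>i\<in>I. b i * t $ i) \<in> N \<rightarrow>\<^sub>M Pi\<^sub>M I (\<lambda>_. borel)"
  by (rule measurable_restrict) measurable

lemma measure_scaled_law:
  "S \<in> sets (Pi\<^sub>M I (\<lambda>_. borel)) \<Longrightarrow> measure (scaled_law b I) S = prob {t. (\<lambda>i\<in>I. b i * t $ i) \<in> S}"
  unfolding scaled_law_def by (subst measure_distr) (auto intro!: arg_cong[where f = prob])

lemma prob_space_scaled_law: "prob_space (scaled_law b I)"
  unfolding scaled_law_def by (rule prob_space_distr) simp

lemma mean_scaled_law:
  assumes "i \<in> I"
  shows "(\<integral>x. x i \<partial>scaled_law b I) = 0"
proof -
  have [measurable]: "(\<lambda>x. x i) \<in> borel_measurable (Pi\<^sub>M I (\<lambda>_. borel))"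
    using assms by (rule measurable_component_singleton)
  show ?thesis
    unfolding scaled_law_def using assms by (subst integral_distr) (auto simp: mean_component)
qed

context
  fixes b :: "'n \<Rightarrow> real" and I :: "'n set"
  assumes b: "\<And>i. 0 < b i" and I: "I \<noteq> {}"
begin

lemma measure_sym_box: "measure (scaled_law b I) (sym_box b I C) = prob (cube I C)"
proof -
  have "{t. (\<lambda>i\<in>I. b i * t $ i) \<in> sym_box b I C} = cube I C"
    using b by (auto simp: mem_sym_box cube_def less_imp_neq[symmetric])
  moreover have "sym_box b I C \<in> sets (Pi\<^sub>M I (\<lambda>_. borel))"
    unfolding sym_box_def by (rule sets_box_on) simp
  ultimately show ?thesis by (simp add: measure_scaled_law)
qed

lemma measure_marginal_le:
  assumes "i \<in> I"
  shows "measure (scaled_law b I) {x \<in> space (scaled_law b I). x i \<le> y} = prob {t. t $ i \<le> y / b i}"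
proof -
  have [measurable]: "(\<lambda>x. x i) \<in> borel_measurable (Pi\<^sub>M I (\<lambda>_. borel))"
    using assms by (rule measurable_component_singleton)
  have "{x \<in> space (Pi\<^sub>M I (\<lambda>_. borel)). x i \<le> y} \<in> sets (Pi\<^sub>M I (\<lambda>_. borel))"
    by measurable
  then show ?thesis
    using assms b[of i]
    by (simp add: space_scaled_law space_PiM measure_scaled_law pos_le_divide_eq mult.commute)
qed

lemma measure_marginal_abs_le:
  assumes "i \<in> I" "0 \<le> h"
  shows "measure (scaled_law b I) {x \<in> space (scaled_law b I). - h \<le> x i \<and> x i \<le> h} = 1 - exp (- h / b i)"
proof -
  have [measurable]: "(\<lambda>x. x i) \<in> borel_measurable (Pi\<^sub>M I (\<lambda>_. borel))"
    using assms(1) by (rule measurable_component_singleton)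
  have "{x \<in> space (Pi\<^sub>M I (\<lambda>_. borel)). - h \<le> x i \<and> x i \<le> h} \<in> sets (Pi\<^sub>M I (\<lambda>_. borel))"
    by measurable
  then have "measure (scaled_law b I) {x \<in> space (scaled_law b I). - h \<le> x i \<and> x i \<le> h}
      = prob {t. - h \<le> b i * t $ i \<and> b i * t $ i \<le> h}"
    using assms by (simp add: space_scaled_law space_PiM measure_scaled_law)
  also have "{t. - h \<le> b i * t $ i \<and> b i * t $ i \<le> h} = {t :: real ^ 'n. \<bar>t $ i\<bar> \<le> h / b i}"
    using b[of i] by (auto simp: abs_le_iff field_simps)
  also have "prob \<dots> = 1 - exp (- h / b i)"
    using assms b[of i] by (simp add: prob_abs_le)
  finally show ?thesis .
qed

text \<open>The rescaled sectors of the shell serve as peelings: each lies beyond its own side, and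
  they share the shell equally.\<close>

lemma peeling_stage_sym_box:
  assumes c: "0 \<le> c" "ereal c \<le> C" and step: "prob (cube I (ereal c)) = (1 - \<alpha>) * prob (cube I C)"
  shows "peeling_stage (scaled_law b I) I \<alpha>
    (\<lambda>i. - (C * ereal (b i))) (\<lambda>i. C * ereal (b i))
    (\<lambda>i. - (ereal c * ereal (b i))) (\<lambda>i. ereal c * ereal (b i))"
  unfolding peeling_stage_def
proof (intro conjI exI ballI)
  fix i
  have "ereal c * ereal (b i) \<le> C * ereal (b i)"
    using c b[of i] by (intro ereal_mult_right_mono) auto
  then show "ereal c * ereal (b i) \<le> C * ereal (b i)" "- (C * ereal (b i)) \<le> - (ereal c * ereal (b i))"
    by (simp_all only: ereal_minus_le_minus)
next
  define R where "R k = {x \<in> I \<rightarrow>\<^sub>E UNIV. (\<lambda>i. x i / b i) \<in> sector I c C k}" for k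
  have R_sub: "R (i, s) \<subseteq> sym_box b I C" for i s
    using b by (auto simp: R_def mem_sym_box sector_def)
  show "R (i, False) \<subseteq> {x \<in> box_on I (\<lambda>i. - (C * ereal (b i))) (\<lambda>i. C * ereal (b i)).
      ereal (x i) < - (ereal c * ereal (b i))}" for i
    using R_sub[of i False] b[of i] unfolding sym_box_def
    by (auto simp: R_def sector_def pos_divide_less_eq)
  show "R (i, True) \<subseteq> {x \<in> box_on I (\<lambda>i. - (C * ereal (b i))) (\<lambda>i. C * ereal (b i)).
      ereal c * ereal (b i) < ereal (x i)}" for i
    using R_sub[of i True] b[of i] unfolding sym_box_def
    by (auto simp: R_def sector_def pos_less_divide_eq)
  show "disjoint_family_on R (I \<times> UNIV)"
    unfolding disjoint_family_on_def
  proof (intro ballI impI)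
    fix k k' assume "k \<in> I \<times> (UNIV :: bool set)" "k' \<in> I \<times> (UNIV :: bool set)" "k \<noteq> k'"
    then have "sector I c C k \<inter> sector I c C k' = {}"
      by (rule disjoint_family_onD[OF disjoint_family_sector[OF c(1)]])
    then show "R k \<inter> R k' = {}" by (auto simp: R_def)
  qed
  have "(\<Union>k\<in>I \<times> UNIV. R k) = {x \<in> I \<rightarrow>\<^sub>E UNIV. (\<lambda>i. x i / b i) \<in> (\<Union>k\<in>I \<times> UNIV. sector I c C k)}"
    by (auto simp: R_def)
  also have "\<dots> = sym_box b I C - sym_box b I (ereal c)"
    using I b by (subst sector_cover) (auto simp: mem_sym_box)
  finally show "(\<Union>k\<in>I \<times> UNIV. R k) = box_on I (\<lambda>i. - (C * ereal (b i))) (\<lambda>i. C * ereal (b i)) -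
      box_on I (\<lambda>i. - (ereal c * ereal (b i))) (\<lambda>i. ereal c * ereal (b i))"
    by (simp only: sym_box_def)
  fix k assume "k \<in> I \<times> (UNIV :: bool set)"
  then obtain i s where k: "k = (i, s)" and i: "i \<in> I" by auto
  have "{x \<in> space (Pi\<^sub>M I (\<lambda>_. borel)). (\<lambda>i. x i / b i) \<in> sector I c C (i, s)} \<in> sets (Pi\<^sub>M I (\<lambda>_. borel))"
    by (rule sets_sector_PiM[OF _ i]) simp
  then have R_sets: "R k \<in> sets (Pi\<^sub>M I (\<lambda>_. borel))"
    by (simp add: R_def k space_PiM)
  then show "R k \<in> sets (scaled_law b I)" by (simp add: sets_scaled_law)
  have "(\<lambda>i\<in>I. b i * t $ i) \<in> R k \<longleftrightarrow> ($) t \<in> sector I c C k" for t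
  proof -
    have "(\<lambda>j. (\<lambda>i\<in>I. b i * t $ i) j / b j) \<in> sector I c C (i, s) \<longleftrightarrow> ($) t \<in> sector I c C (i, s)"
      using b less_imp_neq[OF b] by (intro sector_cong i) auto
    then show ?thesis by (simp add: R_def k)
  qed
  then have "measure (scaled_law b I) (R k) = prob {t. ($) t \<in> sector I c C k}"
    using R_sets by (simp add: measure_scaled_law)
  also have "\<dots> = (prob (cube I C) - prob (cube I (ereal c))) / (2 * card I)"
    unfolding k by (rule prob_sector[OF c i])
  \<comment> \<open>By \<open>step\<close> the whole shell has probability
    \<open>\<alpha> * prob (cube I C)\<close>.\<close>
  also have "\<dots> = \<alpha> / (2 * real (card I)) * prob (cube I C)"
    by (simp add: step algebra_simps)
  finally show "measure (scaled_law b I) (R k) = \<alpha> / (2 * real (card I)) *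
      measure (scaled_law b I) (box_on I (\<lambda>i. - (C * ereal (b i))) (\<lambda>i. C * ereal (b i)))"
    using measure_sym_box[of C] by (simp add: sym_box_def)
qed

text \<open>Whatever peelings are chosen, the stages leave probability \<beta>. Centring and equal
  marginals make the half-widths proportional to the scales, and strict monotonicity then fixes the
  factor.\<close>

lemma fastPRIM_box_unique:
  assumes B: "fastPRIM_box (scaled_law b I) I \<alpha> L B"
    and \<beta>: "(1 - \<alpha>) ^ L = \<beta>" "0 < \<beta>"
    and c: "0 < c" "prob (cube I (ereal c)) = \<beta>"
  shows "B = sym_box b I (ereal c)"
proof -
  let ?Q = "scaled_law b I"
  interpret Q: prob_space ?Q by (rule prob_space_scaled_law)
  obtain l u h \<gamma> where init: "l 0 = (\<lambda>_. -\<infinity>)" "u 0 = (\<lambda>_. \<infinity>)"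
    and stage: "\<And>k. k < L \<Longrightarrow> peeling_stage ?Q I \<alpha> (l k) (u k) (l (Suc k)) (u (Suc k))"
    and B_eq: "B = box_on I (l L) (u L)"
    and lu: "\<And>i. i \<in> I \<Longrightarrow> l L i = ereal (- h i)" "\<And>i. i \<in> I \<Longrightarrow> u L i = ereal (h i)"
    and marg: "\<And>i. i \<in> I \<Longrightarrow> measure ?Q {x \<in> space ?Q. l L i \<le> ereal (x i) \<and> ereal (x i) \<le> u L i} = \<gamma>"
    using B unfolding fastPRIM_box_def by (auto simp: mean_scaled_law)
  have "measure ?Q (box_on I (l k) (u k)) = (1 - \<alpha>) ^ k" if "k \<le> L" for k
    using that
  proof (induction k)
    case 0
    have "box_on I (l 0) (u 0) = space ?Q"
      by (simp add: init box_on_def space_scaled_law)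
    then show ?case using Q.prob_space by simp
  next
    case (Suc k)
    then show ?case
      using measure_peeling_stage[OF Q.finite_measure_axioms sets_scaled_law _ I stage[of k]] by simp
  qed
  then have B_prob: "measure ?Q B = \<beta>" by (simp add: B_eq \<beta>)
  \<comment> \<open>A negative half-width would make the box empty, contrary to
    \<open>0 < \<beta>\<close>.\<close>
  have h: "0 \<le> h i" if i: "i \<in> I" for i
  proof (rule ccontr)
    assume "\<not> 0 \<le> h i"
    then have "x \<notin> B" for x
      using i lu[OF i] unfolding B_eq box_on_def by (auto intro!: bexI[of _ i])
    then have "B = {}" by blast
    then show False using B_prob \<beta>(2) by simp
  qed
  have \<gamma>: "\<gamma> = 1 - exp (- h i / b i)" if i: "i \<in> I" for i
    using marg[OF i] measure_marginal_abs_le[OF i h[OF i]] lu[OF i] by simp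
  obtain j where j: "j \<in> I" using I by blast
  define d where "d = h j / b j"
  \<comment> \<open>The marginal probability is an injective function of \<open>h i / b i\<close>,
    so this ratio is the same for all sides; \<open>d\<close> reads it off at
    \<open>j\<close>.\<close>
  have "h i = d * b i" if i: "i \<in> I" for i
    using \<gamma>[OF i] \<gamma>[OF j] b[of i] by (simp add: d_def field_simps)
  then have B_sym: "B = sym_box b I (ereal d)"
    unfolding B_eq sym_box_def using lu by (intro box_on_cong) auto
  have "prob (cube I (ereal d)) = \<beta>"
    using B_prob measure_sym_box by (simp add: B_sym)
  then have "prob (cube I (ereal d)) = prob (cube I (ereal c))" by (simp add: c(2))
  moreover have "0 \<le> d" using h[OF j] b[of j] by (simp add: d_def)
  ultimately have "d = c" using prob_cube_inj[OF I] c(1) by (simp add: less_imp_le)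
  then show ?thesis by (simp add: B_sym)
qed

text \<open>Existence: cubes of probability \<open>(1 - \<alpha>) ^ k\<close> are available for each
  \<open>k\<close>, are nested by strict monotonicity, and consecutive ones form a peeling
  stage.\<close>

lemma fastPRIM_box_sym_box:
  assumes \<alpha>: "0 < \<alpha>" "\<alpha> < 1" and \<beta>: "(1 - \<alpha>) ^ L = \<beta>" "\<beta> < 1"
    and c: "0 < c" "prob (cube I (ereal c)) = \<beta>"
  shows "fastPRIM_box (scaled_law b I) I \<alpha> L (sym_box b I (ereal c))"
proof -
  let ?Q = "scaled_law b I"
  have "\<exists>x>0. prob (cube I (ereal x)) = (1 - \<alpha>) ^ Suc k" for k
    using prob_cube_surj[OF I, of "(1 - \<alpha>) ^ Suc k"] \<alpha> by (metis diff_gt_0_iff_gt diff_less_eq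
      less_add_same_cancel1 power_Suc_less_one zero_less_power)
  then obtain r where r: "\<And>k. 0 < r k" "\<And>k. prob (cube I (ereal (r k))) = (1 - \<alpha>) ^ Suc k"
    by metis
  \<comment> \<open>\<open>C k\<close> is the half-width after \<open>k\<close> stages, starting
    from the whole space; hence the shift by one against \<open>r\<close>.\<close>
  define C where "C k = (case k of 0 \<Rightarrow> \<infinity> | Suc k \<Rightarrow> ereal (r k))" for k
  have C_prob: "prob (cube I (C k)) = (1 - \<alpha>) ^ k" for k
    by (cases k) (auto simp: C_def r)
  have r_le: "ereal (r k) \<le> C k" for k
  proof (cases k)
    case (Suc m)
    have "(1 - \<alpha>) ^ Suc k < (1 - \<alpha>) ^ Suc m"
      using \<alpha> by (simp add: Suc power_strict_decreasing)
    then have "\<not> r m < r k"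
      using prob_cube_strict_mono[OF I, of "r m" "r k"] r(1)[of m] by (auto simp: r(2))
    then show ?thesis by (simp add: C_def Suc)
  qed (simp add: C_def)
  \<comment> \<open>There is at least one stage, since no stage would leave probability 1, while
    \<open>\<beta> < 1\<close>.\<close>
  obtain L' where L': "L = Suc L'" using \<beta> by (cases L) auto
  have "prob (cube I (ereal (r L'))) = prob (cube I (ereal c))"
    using r(2)[of L'] \<beta>(1) c(2) by (simp add: L')
  from prob_cube_inj[OF I _ _ this] have "r L' = c"
    using c(1) r(1)[of L'] by (simp add: less_imp_le)
  then have CL: "C L = ereal c" by (simp add: C_def L')
  show ?thesis
    unfolding fastPRIM_box_def
  proof (intro exI conjI)
    let ?l = "\<lambda>k i. - (C k * ereal (b i))" and ?u = "\<lambda>k i. C k * ereal (b i)"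
    show "?l 0 = (\<lambda>_. -\<infinity>)" "?u 0 = (\<lambda>_. \<infinity>)"
      using b by (simp_all add: C_def fun_eq_iff less_imp_neq[OF b, symmetric])
    show "\<forall>k<L. peeling_stage ?Q I \<alpha> (?l k) (?u k) (?l (Suc k)) (?u (Suc k))"
    proof (intro allI impI)
      fix k
      have "C (Suc k) = ereal (r k)" by (simp add: C_def)
      then show "peeling_stage ?Q I \<alpha> (?l k) (?u k) (?l (Suc k)) (?u (Suc k))"
        using peeling_stage_sym_box[of "r k" "C k" \<alpha>] r(1)[of k] r_le[of k]
        by (simp add: C_prob r(2))
    qed
    show "sym_box b I (ereal c) = box_on I (?l L) (?u L)"
      by (simp add: sym_box_def CL)
    show "\<forall>i\<in>I. ?l L i = ereal ((\<integral>x. x i \<partial>?Q) - c * b i) \<and> ?u L i = ereal ((\<integral>x. x i \<partial>?Q) + c * b i)"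
      by (simp add: CL mean_scaled_law)
    show "\<forall>i\<in>I. measure ?Q {x \<in> space ?Q. ?l L i \<le> ereal (x i) \<and> ereal (x i) \<le> ?u L i} = 1 - exp (- c)"
    proof
      fix i assume "i \<in> I"
      then show "measure ?Q {x \<in> space ?Q. ?l L i \<le> ereal (x i) \<and> ereal (x i) \<le> ?u L i} = 1 - exp (- c)"
        using measure_marginal_abs_le[of i "c * b i"] c b[of i] by (simp add: CL)
    qed
  qed
qed

text \<open>In the standardized scale a coordinate lies within \<open>c\<close> of 0 with
  probability \<open>1 - exp (- c)\<close>, so the marginal probability \<open>g\<close> corresponds
  to \<open>c = - ln (1 - g)\<close>.\<close>

lemma fastPRIM_quantile_box_eq:
  assumes \<beta>: "0 < \<beta>" "\<beta> < 1"
  shows "fastPRIM_quantile_box (scaled_law b I) I \<beta> =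
    sym_box b I (ereal (- ln (1 - \<beta> powr (1 / card I))))"
proof -
  let ?Q = "scaled_law b I"
  define g where "g = \<beta> powr (1 / card I)"
  have "0 < card I" using I by (simp add: card_gt_0_iff)
  then have g: "0 < g" "g < 1"
    using \<beta> powr_less_mono2[of "1 / card I" \<beta> 1] by (auto simp: g_def)
  \<comment> \<open>The assumption makes \<open>x\<close> the standardized quantile; the infimum is
    then taken over a closed half-line.\<close>
  have quantile: "marginal_quantile ?Q i q = x * b i"
    if i: "i \<in> I" and q: "\<And>y. q \<le> prob {t. t $ i \<le> y} \<longleftrightarrow> x \<le> y" for i q x
  proof -
    have "{t. q \<le> measure ?Q {x \<in> space ?Q. x i \<le> t}} = {y. x \<le> y / b i}"
      by (simp only: measure_marginal_le[OF i] q)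
    also have "\<dots> = {x * b i..}"
      by (simp only: pos_le_divide_eq[OF b] atLeast_def)
    finally have "{t. q \<le> measure ?Q {x \<in> space ?Q. x i \<le> t}} = {x * b i..}" .
    then show ?thesis by (simp add: marginal_quantile_def)
  qed
  have ln: "ln (1 - g) < 0" using g by simp
  \<comment> \<open>This level is above \<open>1 / 2\<close>, so no negative \<open>y\<close>
    reaches it; the level in \<open>lower\<close> is below \<open>1 / 2\<close>, so every
    nonnegative \<open>y\<close> does.\<close>
  have upper: "(1 + g) / 2 \<le> prob {t. t $ i \<le> y} \<longleftrightarrow> - ln (1 - g) \<le> y" for i y
  proof (cases "0 \<le> y")
    case True
    have "(1 + g) / 2 \<le> 1 - exp (- y) / 2 \<longleftrightarrow> exp (- y) \<le> 1 - g" by auto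
    also have "\<dots> \<longleftrightarrow> - y \<le> ln (1 - g)" using g by (simp add: ln_ge_iff)
    finally show ?thesis using True by (auto simp: prob_le)
  next
    case False
    then have "exp y < 1" by simp
    from add_strict_mono[OF this g(1)] have "exp y < 1 + g" by simp
    then have "\<not> (1 + g) / 2 \<le> exp y / 2" by simp
    moreover have "\<not> - ln (1 - g) \<le> y" using False ln by linarith
    ultimately show ?thesis using False by (simp only: prob_le if_False)
  qed
  have lower: "(1 - g) / 2 \<le> prob {t. t $ i \<le> y} \<longleftrightarrow> ln (1 - g) \<le> y" for i y
  proof (cases "0 \<le> y")
    case True
    then have "exp (- y) \<le> 1" by simp
    from add_mono[OF this less_imp_le[OF g(1)]] have "exp (- y) \<le> 1 + g" by simp
    then have "(1 - g) / 2 \<le> 1 - exp (- y) / 2" by (simp add: field_simps)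
    moreover have "ln (1 - g) \<le> y" using True ln by linarith
    ultimately show ?thesis using True by (simp only: prob_le if_True)
  next
    case False
    have "1 - g \<le> exp y \<longleftrightarrow> ln (1 - g) \<le> y" using g by (metis diff_gt_0_iff_gt ln_le_cancel_iff exp_gt_zero ln_exp)
    with False show ?thesis by (auto simp: prob_le)
  qed
  show ?thesis
    unfolding fastPRIM_quantile_box_def sym_box_def g_def[symmetric]
    by (intro box_on_cong) (simp_all add: quantile[OF _ upper] quantile[OF _ lower])
qed

end

end

section \<open>Volumes\<close>

text \<open>If \<open>I\<close> is optimal, exchanging one \<open>i\<close> for an outside
  \<open>j\<close> cannot lower the product. Conversely, a bijection from \<open>I - J\<close> to
  \<open>J - I\<close> replaces each factor by one at least as large, while the common factors
  stay.\<close>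

lemma prod_le_prod_iff_smallest:
  fixes b :: "'n::finite \<Rightarrow> real"
  assumes b: "\<And>i. 0 < b i"
  shows "(\<forall>J. card J = card I \<longrightarrow> prod b I \<le> prod b J) \<longleftrightarrow> (\<forall>i\<in>I. \<forall>j\<in>- I. b i \<le> b j)"
proof (intro iffI ballI allI impI)
  fix i j assume min: "\<forall>J. card J = card I \<longrightarrow> prod b I \<le> prod b J" and i: "i \<in> I" and j: "j \<in> - I"
  have "0 < card I" using i by (auto simp: card_gt_0_iff)
  then have "card (insert j (I - {i})) = card I"
    using i j by simp
  with min have "prod b I \<le> prod b (insert j (I - {i}))" by blast
  moreover have "prod b I = b i * prod b (I - {i})"
    using i by (simp add: prod.remove)
  moreover have "prod b (insert j (I - {i})) = b j * prod b (I - {i})"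
    using j by simp
  moreover have "0 < prod b (I - {i})" by (simp add: prod_pos b)
  ultimately show "b i \<le> b j" by (simp add: mult_le_cancel_right)
next
  fix J :: "'n set" assume small: "\<forall>i\<in>I. \<forall>j\<in>- I. b i \<le> b j" and card: "card J = card I"
  have "card (I - J) = card (J - I)"
    using card card_Int_Diff[of I J] card_Int_Diff[of J I] by (simp add: Int_commute)
  then obtain f where f: "bij_betw f (I - J) (J - I)"
    using finite_same_card_bij[of "I - J" "J - I"] by auto
  have "prod b (I - J) \<le> (\<Prod>i\<in>I - J. b (f i))"
  proof (rule prod_mono)
    fix i assume i: "i \<in> I - J"
    then have "f i \<in> J - I" using f by (auto simp: bij_betw_def)
    then show "0 \<le> b i \<and> b i \<le> b (f i)" using small i b[of i] by auto
  qed
  also have "\<dots> = prod b (J - I)" by (rule prod.reindex_bij_betw[OF f])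
  finally have "prod b (I \<inter> J) * prod b (I - J) \<le> prod b (J \<inter> I) * prod b (J - I)"
    using b by (simp add: Int_commute mult_left_mono prod_nonneg less_imp_le)
  then show "prod b I \<le> prod b J"
    using prod.Int_Diff[of I b J] prod.Int_Diff[of J b I] by simp
qed

lemma Vol_sym_box:
  assumes b: "\<And>i. 0 < b i" and I: "finite I" and c: "0 < c"
  shows "Vol (I, sym_box b I (ereal c)) = ennreal ((2 * c) ^ card I * prod b I)"
proof -
  interpret product_sigma_finite "\<lambda>_. lborel :: real measure" ..
  have "sym_box b I (ereal c) = Pi\<^sub>E I (\<lambda>i. {- (c * b i)..c * b i})"
    by (auto simp: sym_box_def box_on_def PiE_def Pi_def)
  then have "Vol (I, sym_box b I (ereal c)) = (\<Prod>i\<in>I. emeasure lborel {- (c * b i)..c * b i})"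
    using I by (simp add: Vol_def emeasure_PiM)
  also have "\<dots> = (\<Prod>i\<in>I. ennreal (2 * c * b i))"
    using b c by (intro prod.cong) (auto simp: less_imp_le)
  also have "\<dots> = ennreal (\<Prod>i\<in>I. 2 * c * b i)"
    using b c by (intro prod_ennreal) (simp add: less_imp_le)
  finally show ?thesis by (simp add: prod.distrib)
qed

text \<open>All volumes share the factor \<open>(2 * c) ^ p\<close>, so only the products of the
  scales are compared. The sets consist of all minimizers, which covers ties.\<close>

lemma arg_min_Vol_sym_box:
  fixes b :: "'n::finite \<Rightarrow> real"
  assumes b: "\<And>i. 0 < b i" and c: "0 < c"
    and \<B>: "\<B> = {(I, B). card I = p \<and> B = sym_box b I (ereal c)}"
  shows "{IB. is_arg_min Vol (\<lambda>IB. IB \<in> \<B>) IB} = {(I, B) \<in> \<B>. \<forall>i\<in>I. \<forall>j\<in>- I. b i \<le> b j}"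
proof -
  have less: "Vol (J, sym_box b J (ereal c)) < Vol (I, sym_box b I (ereal c)) \<longleftrightarrow> prod b J < prod b I"
    if "card I = p" "card J = p" for I J
    using that b c
    by (simp add: Vol_sym_box ennreal_less_iff prod_nonneg less_imp_le mult_less_cancel_left_pos)
  have "is_arg_min Vol (\<lambda>IB. IB \<in> \<B>) (I, B) \<longleftrightarrow> (I, B) \<in> \<B> \<and> (\<forall>i\<in>I. \<forall>j\<in>- I. b i \<le> b j)" for I B
  proof (cases "(I, B) \<in> \<B>")
    case True
    then have IB: "card I = p" "B = sym_box b I (ereal c)" by (auto simp: \<B>)
    have "is_arg_min Vol (\<lambda>IB. IB \<in> \<B>) (I, B) \<longleftrightarrow> (\<forall>J. card J = card I \<longrightarrow> prod b I \<le> prod b J)"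
      using less[OF IB(1)] True unfolding is_arg_min_def by (auto simp: \<B> IB not_less[symmetric])
    then show ?thesis using True prod_le_prod_iff_smallest[OF b, of I] by simp
  qed (simp add: is_arg_min_def)
  then show ?thesis by auto
qed

theorem theorem4:
  fixes M :: "'a measure"
    and X :: "'a \<Rightarrow> real ^ 'n"
    and \<Sigma> :: "real ^ 'n ^ 'n"
    and b :: "'n \<Rightarrow> real"
    and p' :: nat
    and \<beta> :: real
    and \<alpha> :: "'n set \<Rightarrow> real"
    and L :: "'n set \<Rightarrow> nat"
  assumes "prob_space M"
    and "symmetric_multivariate_laplace M X \<Sigma>"
    and "\<And>i. 0 < b i"
    and "\<And>i. distributed M lborel (\<lambda>\<omega>. X \<omega> $ i) (laplace_density (b i))"
    and "\<And>i j. i \<noteq> j \<Longrightarrow> corr M (\<lambda>\<omega>. X \<omega> $ i) (\<lambda>\<omega>. X \<omega> $ j) = 0"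
    and "1 \<le> p'" and "p' < CARD('n)"
    and "0 < \<beta>" and "\<beta> < 1"
    and "\<And>I. card I = p' \<Longrightarrow> 0 < \<alpha> I \<and> \<alpha> I < 1 \<and> (1 - \<alpha> I) ^ L I = \<beta>"
  shows "(\<forall>I. card I = p' \<longrightarrow>
            (\<exists>!B. fastPRIM_box (proj_law M X I) I (\<alpha> I) (L I) B)) \<and>
         {IB. is_arg_min Vol (\<lambda>IB. IB \<in> fastPRIM_boxes M X p' \<alpha> L) IB}
           = {(I, B) \<in> fastPRIM_boxes M X p' \<alpha> L. pettiest M X I} \<and>
         {IB. is_arg_min Vol (\<lambda>IB. IB \<in> fastPRIM_quantile_boxes M X p' \<beta>) IB}
           = {(I, B) \<in> fastPRIM_quantile_boxes M X p' \<beta>. pettiest M X I}"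
proof -
  interpret M: prob_space M by fact
  note b = assms(3) and dist = assms(4)
  have X_borel: "X \<in> borel_measurable M"
    using assms(2) by (simp add: symmetric_multivariate_laplace_def)
  define T :: "'a \<Rightarrow> real ^ 'n" where "T = (\<lambda>\<omega>. \<chi> i. X \<omega> $ i / b i)"
  have T_borel: "T \<in> borel_measurable M"
  proof -
    have "(\<lambda>x :: real ^ 'n. \<chi> i. x $ i / b i) \<in> borel_measurable borel"
      using b by (intro borel_measurable_continuous_onI continuous_intros) (auto simp: less_le)
    from measurable_compose[OF X_borel this] show ?thesis by (simp add: T_def)
  qed
  define N where "N = distr M borel T"
  interpret spherical_laplace N
    unfolding N_def T_def by (rule spherical_laplace_standardized) (fact assms)+
  have proj: "proj_law M X I = scaled_law b I" for I
  proof -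
    have scale: "(\<lambda>t :: real ^ 'n. \<lambda>i\<in>I. b i * t $ i) \<in> borel \<rightarrow>\<^sub>M Pi\<^sub>M I (\<lambda>_. borel)"
      by (rule measurable_restrict) measurable
    have "scaled_law b I = distr M (Pi\<^sub>M I (\<lambda>_. borel)) (\<lambda>\<omega>. \<lambda>i\<in>I. b i * T \<omega> $ i)"
      unfolding scaled_law_def by (simp add: N_def distr_distr[OF scale T_borel] comp_def)
    moreover have "(\<lambda>\<omega>. \<lambda>i\<in>I. b i * T \<omega> $ i) = (\<lambda>\<omega>. \<lambda>i\<in>I. X \<omega> $ i)"
      using b by (auto simp: T_def fun_eq_iff restrict_def less_le)
    ultimately show ?thesis by (simp add: proj_law_def)
  qed
  have nonempty: "I \<noteq> {}" if "card I = p'" for I :: "'n set"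
    using that assms(6) by auto
  \<comment> \<open>Coordinate \<open>i\<close> has variance \<open>2 * (b i)\<^sup>2\<close>, so
    the order of the variances is that of the scales.\<close>
  have pettiest: "pettiest M X I \<longleftrightarrow> (\<forall>i\<in>I. \<forall>j\<in>- I. b i \<le> b j)" for I
    using b by (simp add: pettiest_def laplace_mean[OF dist b] laplace_second_moment(2)[OF dist b]
        power_mono_iff less_imp_le)

  \<comment> \<open>An arbitrary reference set: the half-width found for it works for every
    \<open>I\<close> of the same size.\<close>
  obtain I0 :: "'n set" where I0: "card I0 = p'"
    using ex_card[of p' "UNIV :: 'n set"] assms(7) by auto
  obtain c where c: "0 < c" "prob (cube I0 (ereal c)) = \<beta>"
    using prob_cube_surj[OF nonempty[OF I0] assms(8,9)] .
  have c_prob: "prob (cube I (ereal c)) = \<beta>" if "card I = p'" for I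
    using prob_cube_card_eq[of I I0] that I0 c(2) by simp
  have box_iff: "fastPRIM_box (proj_law M X I) I (\<alpha> I) (L I) B \<longleftrightarrow> B = sym_box b I (ereal c)"
    if I: "card I = p'" for I B
  proof -
    have \<alpha>: "0 < \<alpha> I" "\<alpha> I < 1" "(1 - \<alpha> I) ^ L I = \<beta>"
      using assms(10)[OF I] by simp_all
    show ?thesis
      unfolding proj
    proof
      assume "fastPRIM_box (scaled_law b I) I (\<alpha> I) (L I) B"
      then show "B = sym_box b I (ereal c)"
        by (rule fastPRIM_box_unique[OF b nonempty[OF I] _ \<alpha>(3) assms(8) c(1) c_prob[OF I]])
    next
      assume B: "B = sym_box b I (ereal c)"
      show "fastPRIM_box (scaled_law b I) I (\<alpha> I) (L I) B"
        unfolding B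
        by (rule fastPRIM_box_sym_box[OF b nonempty[OF I] \<alpha> assms(9) c(1) c_prob[OF I]])
    qed
  qed
  have boxes: "fastPRIM_boxes M X p' \<alpha> L = {(I, B). card I = p' \<and> B = sym_box b I (ereal c)}"
    by (auto simp: fastPRIM_boxes_def box_iff)

  \<comment> \<open>The quantile boxes also have one half-width for all \<open>I\<close>, since
    theirs depends only on \<open>card I\<close>.\<close>
  define d where "d = - ln (1 - \<beta> powr (1 / p'))"
  have "0 < \<beta> powr (1 / p')" "\<beta> powr (1 / p') < 1"
    using assms(6,8,9) powr_less_mono2[of "1 / p'" \<beta> 1] by auto
  then have d: "0 < d" by (simp add: d_def)
  have quantile_boxes:
    "fastPRIM_quantile_boxes M X p' \<beta> = {(I, B). card I = p' \<and> B = sym_box b I (ereal d)}"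
  proof -
    have "fastPRIM_quantile_box (proj_law M X I) I \<beta> = sym_box b I (ereal d)" if "card I = p'" for I
      using fastPRIM_quantile_box_eq[OF b nonempty[OF that] assms(8,9)] that by (simp add: proj d_def)
    then show ?thesis by (auto simp: fastPRIM_quantile_boxes_def)
  qed

  show ?thesis
  proof (intro conjI allI impI)
    fix I :: "'n set" assume "card I = p'"
    then show "\<exists>!B. fastPRIM_box (proj_law M X I) I (\<alpha> I) (L I) B"
      by (simp add: box_iff)
  qed (simp_all only: pettiest arg_min_Vol_sym_box[OF b c(1) boxes] arg_min_Vol_sym_box[OF b d quantile_boxes])
qed

end
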